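(* Let $(R,\mathfrak{m})$ be a one-dimensional Cohen–Macaulay local ring and let $I,J$ be regular stable trace ideals of $R$. Then $$\operatorname{Hom}_R(I,J)\cong\operatorname{Hom}_R(J,I)\cong\operatorname{tr}(IJ).$$ If moreover $I\cap J$ is also a stable trace ideal, then $\operatorname{tr}(IJ)\cong I\cap J$.
   Context: An ideal is regular if it contains a nonzerodivisor. For an $R$-module $N$, $N^*=\operatorname{Hom}_R(N,R)$ and $\operatorname{tr}(N)$ is the image of $N\otimes_R N^*\to R$, $n\otimes\alpha\mapsto\alpha(n)$; an ideal $I$ is a trace ideal if $I=\operatorname{tr}(N)$ for some $R$-module $N$ (equivalently $\operatorname{tr}(I)=I$). $Q(R)$ is the total quotient ring. For a regular ideal $I$, $B_R(I)=\bigcup_{n>0}(I^n:_{Q(R)}I^n)$, and $I$ is stable if $B_R(I)=I:_{Q(R)}I$. *)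

theory Defs
  imports Main "HOL-Library.Extended_Nat"
begin

definition is_ideal :: "'a::comm_ring_1 set \<Rightarrow> bool" where
  "is_ideal K \<longleftrightarrow> 0 \<in> K \<and> (\<forall>x\<in>K. \<forall>y\<in>K. x + y \<in> K) \<and> (\<forall>r. \<forall>x\<in>K. r * x \<in> K)"

definition ideal_gen :: "'a::comm_ring_1 set \<Rightarrow> 'a set" where
  "ideal_gen S = \<Inter>{K. is_ideal K \<and> S \<subseteq> K}"

definition prime_ideal :: "'a::comm_ring_1 set \<Rightarrow> bool" where
  "prime_ideal P \<longleftrightarrow> is_ideal P \<and> P \<noteq> UNIV \<and> (\<forall>x y. x * y \<in> P \<longrightarrow> x \<in> P \<or> y \<in> P)"

definition noetherian :: "'a::comm_ring_1 itself \<Rightarrow> bool" where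
  "noetherian _ \<longleftrightarrow> (\<forall>K::'a set. is_ideal K \<longrightarrow> (\<exists>F. finite F \<and> K = ideal_gen F))"

definition local_ring :: "'a::comm_ring_1 set \<Rightarrow> bool" where
  "local_ring m \<longleftrightarrow> is_ideal m \<and> m \<noteq> UNIV \<and> (\<forall>K. is_ideal K \<and> K \<noteq> UNIV \<longrightarrow> K \<subseteq> m)"

definition krull_dim :: "'a::comm_ring_1 itself \<Rightarrow> enat" where
  "krull_dim _ = Sup {enat n | n. \<exists>P :: nat \<Rightarrow> 'a set.
      (\<forall>i\<le>n. prime_ideal (P i)) \<and> (\<forall>i<n. P i \<subset> P (Suc i))}"

definition regular_seq :: "'a::comm_ring_1 set \<Rightarrow> 'a list \<Rightarrow> bool" where
  "regular_seq m xs \<longleftrightarrow> set xs \<subseteq> m \<and>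
     (\<forall>i<length xs. \<forall>y. xs ! i * y \<in> ideal_gen (set (take i xs)) \<longrightarrow> y \<in> ideal_gen (set (take i xs))) \<and>
     ideal_gen (set xs) \<noteq> UNIV"

definition depth :: "'a::comm_ring_1 set \<Rightarrow> enat" where
  "depth m = Sup {enat (length xs) | xs. regular_seq m xs}"

definition nzd :: "'a::comm_ring_1 \<Rightarrow> bool" where
  "nzd s \<longleftrightarrow> (\<forall>x. s * x = 0 \<longrightarrow> x = 0)"

definition regular_ideal :: "'a::comm_ring_1 set \<Rightarrow> bool" where
  "regular_ideal K \<longleftrightarrow> (\<exists>s\<in>K. nzd s)"

definition ideal_prod :: "'a::comm_ring_1 set \<Rightarrow> 'a set \<Rightarrow> 'a set" where
  "ideal_prod K L = {\<Sum>i<k. a i * b i | (k::nat) a b. \<forall>i<k. a i \<in> K \<and> b i \<in> L}"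

fun ideal_pow :: "'a::comm_ring_1 set \<Rightarrow> nat \<Rightarrow> 'a set" where
  "ideal_pow K 0 = UNIV"
| "ideal_pow K (Suc n) = ideal_prod K (ideal_pow K n)"

definition Hom :: "'a::comm_ring_1 set \<Rightarrow> 'a set \<Rightarrow> ('a \<Rightarrow> 'a) set" where
  "Hom K L = {f. (\<forall>x\<in>K. \<forall>y\<in>K. f (x + y) = f x + f y) \<and> (\<forall>r. \<forall>x\<in>K. f (r * x) = r * f x)
               \<and> f ` K \<subseteq> L \<and> (\<forall>x. x \<notin> K \<longrightarrow> f x = 0)}"

definition hom_add :: "('a::comm_ring_1 \<Rightarrow> 'a) \<Rightarrow> ('a \<Rightarrow> 'a) \<Rightarrow> ('a \<Rightarrow> 'a)" where
  "hom_add f g = (\<lambda>x. f x + g x)"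

definition hom_smult :: "'a::comm_ring_1 \<Rightarrow> ('a \<Rightarrow> 'a) \<Rightarrow> ('a \<Rightarrow> 'a)" where
  "hom_smult r f = (\<lambda>x. r * f x)"

text \<open>Trace: image of K \<otimes> K* \<rightarrow> R, i.e. all finite sums of alpha(n), alpha \<in> Hom(K,R), n \<in> K.\<close>
definition trace :: "'a::comm_ring_1 set \<Rightarrow> 'a set" where
  "trace K = {\<Sum>i<k. \<alpha> i (n i) | (k::nat) \<alpha> n. \<forall>i<k. \<alpha> i \<in> Hom K UNIV \<and> n i \<in> K}"

definition trace_ideal :: "'a::comm_ring_1 set \<Rightarrow> bool" where
  "trace_ideal K \<longleftrightarrow> is_ideal K \<and> trace K = K"

definition mod_iso :: "'m set \<Rightarrow> ('m \<Rightarrow> 'm \<Rightarrow> 'm) \<Rightarrow> ('a \<Rightarrow> 'm \<Rightarrow> 'm)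
    \<Rightarrow> 'n set \<Rightarrow> ('n \<Rightarrow> 'n \<Rightarrow> 'n) \<Rightarrow> ('a \<Rightarrow> 'n \<Rightarrow> 'n) \<Rightarrow> bool" where
  "mod_iso M addM smM N addN smN \<longleftrightarrow> (\<exists>\<phi>. bij_betw \<phi> M N
      \<and> (\<forall>x\<in>M. \<forall>y\<in>M. \<phi> (addM x y) = addN (\<phi> x) (\<phi> y))
      \<and> (\<forall>r. \<forall>x\<in>M. \<phi> (smM r x) = smN r (\<phi> x)))"

text \<open>Elements of Q(R) are represented by pairs (a,s) = a/s with s a nonzerodivisor.
  For an ideal K, a/s \<in> (K :_Q(R) K) iff a K \<subseteq> s K; this membership depends only on the
  fraction a/s, so sets of representatives faithfully represent subsets of Q(R).\<close>
definition colon_Q :: "'a::comm_ring_1 set \<Rightarrow> ('a \<times> 'a) set" where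
  "colon_Q K = {(a, s). nzd s \<and> (\<forall>k\<in>K. \<exists>k'\<in>K. a * k = s * k')}"

definition blowup :: "'a::comm_ring_1 set \<Rightarrow> ('a \<times> 'a) set" where
  "blowup K = (\<Union>n\<in>{n. n > 0}. colon_Q (ideal_pow K n))"

definition stable :: "'a::comm_ring_1 set \<Rightarrow> bool" where
  "stable K \<longleftrightarrow> regular_ideal K \<and> blowup K = colon_Q K"

end

(* For a regular stable ideal I there is a nonzerodivisor z in I with I^2 = zI, whatever the residue
   field. Since R/sR has finite length for a nonzerodivisor s of m, the numbers of generators of the
   powers of I are bounded, so the fibre ring of I has dimension at most one. Hence in every large
   degree d some c in I^d generates an ideal of the Rees algebra that has, modulo m, the radical of
   the irrelevant ideal, and Nakayama gives I^(n+d) = c I^n for large n. Stability turns this into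
   I^(d+1) = c I, and the quotient of the elements c of two consecutive degrees is z.

   Given I^2 = zI and J^2 = wJ, the map f |-> f(z) identifies Hom(I,J) with (zJ : I). For trace
   ideals this equals T = (zwR : IJ), which is symmetric in I and J and equals tr(IJ). If the
   intersection K of I and J is a trace ideal, then x/z and y/w, for x in I and y in J, map K to R,
   hence to K, and so T = K. *)
theory Submission
  imports Defs "HOL-Computational_Algebra.Polynomial"
begin

section \<open>Ideals\<close>

text \<open>Over a finite residue field an ideal may have no principal reduction although some of
  its powers do, so a single degree gives nothing in I itself. Existence in all large degrees makes
  two consecutive ones available, and their quotient has degree one. Stability enters through
  fractions: if x lies in I^d and n is large, x/c maps I^n into itself, so x/c lies in B(I) = I : I.
  This brings the exponent n down to 1. No quotient ring, quotient module or localisation is formed.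
  The primes of the fibre ring are the primes of R[It] that contain mR[It]; a length is a bound on
  chains of ideals; a fraction a/c acts through the equation a k = c k'.\<close>

lemma is_idealI:
  assumes "0 \<in> K" "\<And>x y. x \<in> K \<Longrightarrow> y \<in> K \<Longrightarrow> x + y \<in> K" "\<And>r x. x \<in> K \<Longrightarrow> r * x \<in> K"
  shows "is_ideal K"
  using assms unfolding is_ideal_def by blast

lemma ideal_0: "is_ideal K \<Longrightarrow> 0 \<in> K"
  and ideal_add: "is_ideal K \<Longrightarrow> x \<in> K \<Longrightarrow> y \<in> K \<Longrightarrow> x + y \<in> K"
  and ideal_mult: "is_ideal K \<Longrightarrow> x \<in> K \<Longrightarrow> r * x \<in> K"
  unfolding is_ideal_def by blast+

lemma ideal_mult2: "is_ideal K \<Longrightarrow> x \<in> K \<Longrightarrow> x * r \<in> K"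
  using ideal_mult[of K x r] by (simp add: mult.commute)

lemma ideal_uminus: "is_ideal K \<Longrightarrow> x \<in> K \<Longrightarrow> - x \<in> K"
  using ideal_mult[of K x "-1"] by simp

lemma ideal_diff: "is_ideal K \<Longrightarrow> x \<in> K \<Longrightarrow> y \<in> K \<Longrightarrow> x - y \<in> K"
  using ideal_add[of K x "-y"] ideal_uminus[of K y] by simp

lemma ideal_sum: "is_ideal K \<Longrightarrow> (\<And>i. i \<in> S \<Longrightarrow> f i \<in> K) \<Longrightarrow> sum f S \<in> K"
  by (induction S rule: infinite_finite_induct) (auto simp: ideal_0 ideal_add)

lemma ideal_UNIV_iff: "is_ideal K \<Longrightarrow> K = UNIV \<longleftrightarrow> 1 \<in> K"
  using ideal_mult[of K 1] by force

lemma is_ideal_UNIV: "is_ideal UNIV"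
  by (rule is_idealI) auto

lemma is_ideal_colon: "is_ideal K \<Longrightarrow> is_ideal {a. a * x \<in> K}"
  by (rule is_idealI) (auto simp: ideal_0 ideal_add ideal_mult distrib_right mult.assoc)

lemma is_ideal_Inter: "(\<And>K. K \<in> C \<Longrightarrow> is_ideal K) \<Longrightarrow> is_ideal (\<Inter>C)"
  by (rule is_idealI) (auto simp: ideal_0 ideal_add ideal_mult)

lemma is_ideal_ideal_gen: "is_ideal (ideal_gen S)"
  unfolding ideal_gen_def by (rule is_ideal_Inter) auto

lemma ideal_gen_superset: "S \<subseteq> ideal_gen S"
  unfolding ideal_gen_def by auto

lemma ideal_gen_least: "is_ideal K \<Longrightarrow> S \<subseteq> K \<Longrightarrow> ideal_gen S \<subseteq> K"
  unfolding ideal_gen_def by auto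

lemma is_ideal_scale:
  assumes "is_ideal K" shows "is_ideal ((*) c ` K)"
proof (rule is_idealI)
  show "0 \<in> (*) c ` K" using ideal_0[OF assms] by (force intro: image_eqI[of _ _ 0])
  show "x + y \<in> (*) c ` K" if xy: "x \<in> (*) c ` K" "y \<in> (*) c ` K" for x y
  proof -
    obtain a b where "a \<in> K" "b \<in> K" "x = c * a" "y = c * b" using xy by auto
    thus ?thesis using ideal_add[OF assms, of a b] by (intro image_eqI[of _ _ "a + b"]) (auto simp: distrib_left)
  qed
  show "r * x \<in> (*) c ` K" if x: "x \<in> (*) c ` K" for r x
  proof -
    obtain a where "a \<in> K" "x = c * a" using x by auto
    thus ?thesis using ideal_mult[OF assms, of a r] by (intro image_eqI[of _ _ "r * a"]) (auto simp: ac_simps)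
  qed
qed

definition adjoin :: "'a::comm_ring_1 set \<Rightarrow> 'a \<Rightarrow> 'a set" where
  "adjoin K x = {a + r * x | a r. a \<in> K}"

lemma adjoinI: "a \<in> K \<Longrightarrow> a + r * x \<in> adjoin K x"
  unfolding adjoin_def by blast

lemma is_ideal_adjoin:
  assumes "is_ideal K" shows "is_ideal (adjoin K x)"
proof (rule is_idealI)
  show "0 \<in> adjoin K x" using adjoinI[OF ideal_0[OF assms], of 0] by simp
  show "u + v \<in> adjoin K x" if uv: "u \<in> adjoin K x" "v \<in> adjoin K x" for u v
  proof -
    obtain a b r s where "a \<in> K" "b \<in> K" "u = a + r * x" "v = b + s * x"
      using uv unfolding adjoin_def by blast
    thus ?thesis using adjoinI[OF ideal_add[OF assms, of a b], of "r + s" x] by (simp add: algebra_simps)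
  qed
  show "t * u \<in> adjoin K x" if u: "u \<in> adjoin K x" for t u
  proof -
    obtain a r where "a \<in> K" "u = a + r * x" using u unfolding adjoin_def by blast
    thus ?thesis using adjoinI[OF ideal_mult[OF assms, of a t], of "t * r" x] by (simp add: algebra_simps)
  qed
qed

lemma adjoin_superset: "K \<subseteq> adjoin K x"
  using adjoinI[where r = 0] by fastforce

lemma adjoin_mem: "is_ideal K \<Longrightarrow> x \<in> adjoin K x"
  using adjoinI[OF ideal_0, where r = 1] by fastforce

lemma adjoin_least: "is_ideal L \<Longrightarrow> K \<subseteq> L \<Longrightarrow> x \<in> L \<Longrightarrow> adjoin K x \<subseteq> L"
  unfolding adjoin_def by (auto intro!: ideal_add ideal_mult)

section \<open>Products and powers of ideals\<close>

lemma ideal_prodI: "a \<in> K \<Longrightarrow> b \<in> L \<Longrightarrow> a * b \<in> ideal_prod K L"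
  unfolding ideal_prod_def
  by (rule CollectI, rule exI[of _ 1], rule exI[of _ "\<lambda>_. a"], rule exI[of _ "\<lambda>_. b"]) auto

lemma is_ideal_ideal_prod:
  assumes "is_ideal K" shows "is_ideal (ideal_prod K L)"
proof (rule is_idealI)
  show "0 \<in> ideal_prod K L" unfolding ideal_prod_def by (force intro: exI[of _ 0])
  show "x + y \<in> ideal_prod K L" if xy: "x \<in> ideal_prod K L" "y \<in> ideal_prod K L" for x y
  proof -
    obtain k :: nat and a b where x: "x = (\<Sum>i<k. a i * b i)" "\<forall>i<k. a i \<in> K \<and> b i \<in> L"
      using xy(1) unfolding ideal_prod_def by blast
    obtain l :: nat and c d where y: "y = (\<Sum>i<l. c i * d i)" "\<forall>i<l. c i \<in> K \<and> d i \<in> L"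
      using xy(2) unfolding ideal_prod_def by blast
    define f where "f i = (if i < k then a i else c (i - k))" for i
    define g where "g i = (if i < k then b i else d (i - k))" for i
    have "(\<Sum>i<k + l. f i * g i) = (\<Sum>i<k. f i * g i) + (\<Sum>i<l. f (k + i) * g (k + i))"
      by (induction l) (auto simp: add.assoc)
    also have "\<dots> = x + y" by (simp add: x y f_def g_def)
    finally have "x + y = (\<Sum>i<k + l. f i * g i)" ..
    moreover have "\<forall>i<k + l. f i \<in> K \<and> g i \<in> L" using x y by (auto simp: f_def g_def)
    ultimately show ?thesis unfolding ideal_prod_def by blast
  qed
  show "r * x \<in> ideal_prod K L" if xx: "x \<in> ideal_prod K L" for r x
  proof -
    obtain k :: nat and a b where x: "x = (\<Sum>i<k. a i * b i)" "\<forall>i<k. a i \<in> K \<and> b i \<in> L"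
      using xx unfolding ideal_prod_def by blast
    have "r * x = (\<Sum>i<k. (r * a i) * b i)" by (simp add: x sum_distrib_left mult.assoc)
    moreover have "\<forall>i<k. r * a i \<in> K \<and> b i \<in> L" using x ideal_mult[OF assms] by auto
    ultimately show ?thesis unfolding ideal_prod_def
      by (intro CollectI exI[of _ k] exI[of _ "\<lambda>i. r * a i"] exI[of _ b]) auto
  qed
qed

lemma ideal_prod_least:
  assumes "is_ideal V" "\<And>a b. a \<in> K \<Longrightarrow> b \<in> L \<Longrightarrow> a * b \<in> V"
  shows "ideal_prod K L \<subseteq> V"
  unfolding ideal_prod_def using assms by (auto intro!: ideal_sum)

lemma ideal_prod_subset: "is_ideal L \<Longrightarrow> ideal_prod K L \<subseteq> L"
  by (rule ideal_prod_least) (auto intro: ideal_mult)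

lemma is_ideal_ideal_pow: "is_ideal K \<Longrightarrow> is_ideal (ideal_pow K n)"
  by (cases n) (auto simp: is_ideal_UNIV is_ideal_ideal_prod)

lemma ideal_pow_mult:
  assumes "is_ideal K"
  shows "a \<in> ideal_pow K p \<Longrightarrow> b \<in> ideal_pow K q \<Longrightarrow> a * b \<in> ideal_pow K (p + q)"
proof (induction p arbitrary: a)
  case 0
  thus ?case using ideal_mult[OF is_ideal_ideal_pow[OF assms]] by auto
next
  case (Suc p)
  have "ideal_pow K (Suc p) \<subseteq> {a. a * b \<in> ideal_pow K (Suc p + q)}"
    unfolding ideal_pow.simps(2)
  proof (rule ideal_prod_least)
    show "is_ideal {a. a * b \<in> ideal_pow K (Suc p + q)}"
      by (intro is_ideal_colon is_ideal_ideal_pow assms)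
    show "x * y \<in> {a. a * b \<in> ideal_pow K (Suc p + q)}" if "x \<in> K" "y \<in> ideal_pow K p" for x y
      using ideal_prodI[OF that(1) Suc.IH[OF that(2) Suc.prems(2)]] by (simp add: mult.assoc)
  qed
  thus ?case using Suc.prems(1) by blast
qed

lemma ideal_pow_add_least:
  assumes "is_ideal K" "is_ideal V"
    and "\<And>a b. a \<in> ideal_pow K p \<Longrightarrow> b \<in> ideal_pow K q \<Longrightarrow> a * b \<in> V"
  shows "ideal_pow K (p + q) \<subseteq> V"
  using assms(2,3)
proof (induction p arbitrary: V)
  case 0
  show ?case using "0.prems"(2)[of 1] by auto
next
  case (Suc p)
  show ?case unfolding add_Suc ideal_pow.simps(2)
  proof (rule ideal_prod_least[OF Suc.prems(1)])
    fix x y assume x: "x \<in> K" and y: "y \<in> ideal_pow K (p + q)"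
    have "ideal_pow K (p + q) \<subseteq> {a. a * x \<in> V}"
    proof (rule Suc.IH)
      show "is_ideal {a. a * x \<in> V}" by (rule is_ideal_colon[OF Suc.prems(1)])
      show "a * b \<in> {a. a * x \<in> V}" if "a \<in> ideal_pow K p" "b \<in> ideal_pow K q" for a b
        using Suc.prems(2)[of "x * a" b] ideal_prodI[OF x that(1)] that(2) by (simp add: ac_simps)
    qed
    thus "x * y \<in> V" using y by (auto simp: mult.commute)
  qed
qed

lemma ideal_pow_1: "is_ideal K \<Longrightarrow> ideal_pow K (Suc 0) = K"
  using ideal_prod_least[of K K UNIV] ideal_prodI[of _ K 1 UNIV] by (auto intro: ideal_mult2)

lemma ideal_pow_power:
  assumes "is_ideal K" "a \<in> ideal_pow K d" shows "a ^ n \<in> ideal_pow K (d * n)"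
proof (induction n)
  case (Suc n)
  thus ?case using ideal_pow_mult[OF assms Suc] by (simp add: ac_simps)
qed simp

text \<open>The sets \<open>V n\<close> play the graded pieces of a homogeneous ideal of the Rees algebra, and the
  conclusion says that this ideal contains all high degrees once its radical contains the generators.\<close>

lemma ideal_pow_subset_graded:
  fixes V :: "nat \<Rightarrow> 'a::comm_ring_1 set"
  assumes K: "K = ideal_gen G" and fin: "finite G"
    and V: "\<And>n. is_ideal (V n)"
    and step: "\<And>n v x. v \<in> V n \<Longrightarrow> x \<in> K \<Longrightarrow> v * x \<in> V (Suc n)"
    and G: "\<And>g. g \<in> G \<Longrightarrow> \<exists>k. g ^ k \<in> V k"
  shows "\<exists>n0. \<forall>n\<ge>n0. ideal_pow K n \<subseteq> V n"
proof -
  have GK: "G \<subseteq> K" unfolding K by (rule ideal_gen_superset)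
  obtain \<kappa> where \<kappa>: "\<And>g. g \<in> G \<Longrightarrow> g ^ \<kappa> g \<in> V (\<kappa> g)" using G by metis
  have step': "v * prod_mset M \<in> V (n + size M)" if "v \<in> V n" "set_mset M \<subseteq> K" for v n M
    using that
  proof (induction M)
    case (add x M)
    thus ?case using step[of "v * prod_mset M" "n + size M" x] by (simp add: ac_simps)
  qed simp
  \<comment> \<open>Pigeonhole: if each \<open>g\<close> occurred fewer than
    \<open>\<kappa> g\<close> times in a monomial, its degree would be at most the sum of the
    \<open>\<kappa> g\<close>; the successor excludes this.\<close>
  define n0 where "n0 = Suc (\<Sum>g\<in>G. \<kappa> g)"
  have monomial: "prod_mset M \<in> V (size M)" if M: "set_mset M \<subseteq> G" "size M \<ge> n0" for M
  proof -
    have "\<exists>g\<in>set_mset M. count M g \<ge> \<kappa> g"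
    proof (rule ccontr)
      assume "\<not> ?thesis"
      hence "sum (count M) (set_mset M) \<le> sum \<kappa> (set_mset M)" by (intro sum_mono) force
      also have "\<dots> \<le> sum \<kappa> G" using M fin by (intro sum_mono2) auto
      finally show False using M(2) by (simp add: size_multiset_overloaded_eq n0_def)
    qed
    then obtain g where g: "g \<in> set_mset M" "count M g \<ge> \<kappa> g" by blast
    then obtain M' where M': "M = replicate_mset (\<kappa> g) g + M'"
      using count_le_replicate_mset_subset_eq mset_subset_eq_exists_conv by metis
    have "g ^ \<kappa> g * prod_mset M' \<in> V (\<kappa> g + size M')"
      using M M' GK g by (intro step' \<kappa>) auto
    thus ?thesis by (simp add: M')
  qed
  \<comment> \<open>The total degree \<open>n\<close> stays fixed while factors of \<open>w\<close>
    are expanded in the generators and moved into \<open>M\<close>; once \<open>l = 0\<close>, only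
    a scalar multiple of a monomial is left.\<close>
  have main: "prod_mset M * w \<in> V n"
    if "n \<ge> n0" "set_mset M \<subseteq> G" "w \<in> ideal_pow K l" "size M + l = n" for M w l n
    using that
  proof (induction l arbitrary: M w)
    case 0
    thus ?case using monomial[of M] ideal_mult2[OF V] by auto
  next
    case (Suc l)
    have "ideal_pow K (Suc l) \<subseteq> {w. w * prod_mset M \<in> V n}"
      unfolding ideal_pow.simps(2)
    proof (rule ideal_prod_least)
      show "is_ideal {w. w * prod_mset M \<in> V n}" by (rule is_ideal_colon[OF V])
      fix a b assume a: "a \<in> K" and b: "b \<in> ideal_pow K l"
      have "K \<subseteq> {a. a * (b * prod_mset M) \<in> V n}" unfolding K
      proof (rule ideal_gen_least[OF is_ideal_colon[OF V]])
        show "G \<subseteq> {a. a * (b * prod_mset M) \<in> V n}"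
          using Suc.IH[of "add_mset _ M" b] Suc.prems b by (auto simp: ac_simps)
      qed
      thus "a * b \<in> {w. w * prod_mset M \<in> V n}" using a by (auto simp: mult.assoc)
    qed
    thus ?case using Suc.prems by (auto simp: mult.commute)
  qed
  have "ideal_pow K n \<subseteq> V n" if "n \<ge> n0" for n
    using main[of n "{#}" _ n] that by auto
  thus ?thesis by blast
qed

section \<open>Prime ideals of subrings\<close>

text \<open>The Rees algebra is a subset of a polynomial type and not a type of its own, so ideals
  and primes are taken relative to a carrier \<open>A\<close>; the carrier \<open>UNIV\<close> gives
  back the usual notions.\<close>

definition subring :: "'a::comm_ring_1 set \<Rightarrow> bool" where
  "subring A \<longleftrightarrow> 0 \<in> A \<and> 1 \<in> A \<and> (\<forall>x\<in>A. \<forall>y\<in>A. x + y \<in> A) \<and> (\<forall>x\<in>A. \<forall>y\<in>A. x * y \<in> A)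
     \<and> (\<forall>x\<in>A. - x \<in> A)"

definition ideal_of :: "'a::comm_ring_1 set \<Rightarrow> 'a set \<Rightarrow> bool" where
  "ideal_of A K \<longleftrightarrow> K \<subseteq> A \<and> 0 \<in> K \<and> (\<forall>x\<in>K. \<forall>y\<in>K. x + y \<in> K) \<and> (\<forall>r\<in>A. \<forall>x\<in>K. r * x \<in> K)"

definition prime_of :: "'a::comm_ring_1 set \<Rightarrow> 'a set \<Rightarrow> bool" where
  "prime_of A P \<longleftrightarrow> ideal_of A P \<and> 1 \<notin> P \<and> (\<forall>x\<in>A. \<forall>y\<in>A. x * y \<in> P \<longrightarrow> x \<in> P \<or> y \<in> P)"

lemma ideal_of_UNIV: "ideal_of UNIV K \<longleftrightarrow> is_ideal K"
  unfolding ideal_of_def is_ideal_def by blast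

lemma prime_of_UNIV: "prime_of UNIV P \<longleftrightarrow> prime_ideal P"
  unfolding prime_of_def prime_ideal_def ideal_of_UNIV using ideal_UNIV_iff[of P] by auto

lemma subring_UNIV: "subring UNIV"
  unfolding subring_def by auto

lemma subring_power: "subring A \<Longrightarrow> x \<in> A \<Longrightarrow> x ^ n \<in> A"
  by (induction n) (auto simp: subring_def)

lemma prime_of_power: "prime_of A P \<Longrightarrow> subring A \<Longrightarrow> x \<in> A \<Longrightarrow> x ^ n \<in> P \<Longrightarrow> x \<in> P"
proof (induction n)
  case 0
  thus ?case unfolding prime_of_def by auto
next
  case (Suc n)
  thus ?case using subring_power[of A x n] unfolding prime_of_def by auto
qed

lemma ideal_of_adjoin:
  assumes A: "subring A" and K: "ideal_of A K" and x: "x \<in> A"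
  shows "ideal_of A {k + r * x | k r. k \<in> K \<and> r \<in> A}" (is "ideal_of A ?L")
    and "K \<subseteq> {k + r * x | k r. k \<in> K \<and> r \<in> A}" and "x \<in> {k + r * x | k r. k \<in> K \<and> r \<in> A}"
proof -
  have 0: "0 \<in> A" "1 \<in> A" "0 \<in> K" using A K unfolding subring_def ideal_of_def by auto
  show "K \<subseteq> ?L" using 0 by force
  show "x \<in> ?L" using 0 by force
  have "u + v \<in> ?L" if uv: "u \<in> ?L" "v \<in> ?L" for u v
  proof -
    obtain k l r s where *: "k \<in> K" "l \<in> K" "r \<in> A" "s \<in> A" "u = k + r * x" "v = l + s * x"
      using uv by blast
    have "u + v = (k + l) + (r + s) * x" "k + l \<in> K" "r + s \<in> A"
      using * A K unfolding subring_def ideal_of_def by (auto simp: algebra_simps)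
    thus ?thesis by blast
  qed
  moreover have "t * u \<in> ?L" if tu: "u \<in> ?L" "t \<in> A" for t u
  proof -
    obtain k r where *: "k \<in> K" "r \<in> A" "u = k + r * x" using tu by blast
    have "t * u = t * k + (t * r) * x" "t * k \<in> K" "t * r \<in> A"
      using * A K tu unfolding subring_def ideal_of_def by (auto simp: algebra_simps)
    thus ?thesis by blast
  qed
  moreover have "0 \<in> ?L" using \<open>K \<subseteq> ?L\<close> 0 by blast
  moreover have "?L \<subseteq> A" using A K x unfolding subring_def ideal_of_def by blast
  ultimately show "ideal_of A ?L" unfolding ideal_of_def by blast
qed

text \<open>Krull's argument: an ideal maximal among those that contain \<open>K\<close> and miss
  the multiplicative set \<open>S\<close> is prime. Zorn's lemma supplies it, since no chain
  condition is established for the Rees algebra.\<close>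

lemma prime_of_avoiding:
  assumes A: "subring A" and K: "ideal_of A K" and S: "S \<subseteq> A" "1 \<in> S"
    "\<And>x y. x \<in> S \<Longrightarrow> y \<in> S \<Longrightarrow> x * y \<in> S" and disj: "K \<inter> S = {}"
  obtains P where "prime_of A P" "K \<subseteq> P" "P \<inter> S = {}"
proof -
  define \<S> where "\<S> = {L. ideal_of A L \<and> K \<subseteq> L \<and> L \<inter> S = {}}"
  have "\<exists>P\<in>\<S>. \<forall>X\<in>\<S>. P \<subseteq> X \<longrightarrow> X = P"
  proof (rule subset_Zorn_nonempty)
    show "\<S> \<noteq> {}" using K disj unfolding \<S>_def by blast
    fix C assume C: "C \<noteq> {}" "subset.chain \<S> C"
    have CS: "ideal_of A L" "K \<subseteq> L" "L \<inter> S = {}" if "L \<in> C" for L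
      using C(2) that unfolding subset.chain_def \<S>_def by auto
    have "x + y \<in> \<Union>C" if xy: "x \<in> \<Union>C" "y \<in> \<Union>C" for x y
    proof -
      obtain X Y where XY: "X \<in> C" "x \<in> X" "Y \<in> C" "y \<in> Y" using xy by blast
      have "X \<subseteq> Y \<or> Y \<subseteq> X" using XY(1,3) C(2) unfolding subset.chain_def by blast
      then obtain Z where Z: "Z \<in> C" "x \<in> Z" "y \<in> Z" using XY by blast
      hence "x + y \<in> Z" using CS(1)[OF Z(1)] unfolding ideal_of_def by simp
      thus ?thesis using Z(1) by blast
    qed
    moreover have "r * x \<in> \<Union>C" if "x \<in> \<Union>C" "r \<in> A" for r x
      using that CS(1) unfolding ideal_of_def by blast
    moreover have "0 \<in> \<Union>C" using C(1) CS(1) unfolding ideal_of_def by blast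
    moreover have "\<Union>C \<subseteq> A" using CS(1) unfolding ideal_of_def by blast
    ultimately have "ideal_of A (\<Union>C)" unfolding ideal_of_def by blast
    thus "\<Union>C \<in> \<S>" using C(1) CS(2,3) unfolding \<S>_def by blast
  qed
  then obtain P where P: "P \<in> \<S>" and max: "\<And>X. X \<in> \<S> \<Longrightarrow> P \<subseteq> X \<Longrightarrow> X = P" by blast
  have Pi: "ideal_of A P" "K \<subseteq> P" "P \<inter> S = {}" using P unfolding \<S>_def by auto
  \<comment> \<open>By maximality, adjoining any \<open>x\<close> outside \<open>P\<close> produces
    an ideal that meets \<open>S\<close>; the product of two such elements of \<open>S\<close> would
    lie in \<open>P\<close> if \<open>x * y\<close> did.\<close>
  have meets: "\<exists>k r. k \<in> P \<and> r \<in> A \<and> k + r * x \<in> S" if x: "x \<in> A" "x \<notin> P" for x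
  proof (rule ccontr)
    assume neg: "\<not> ?thesis"
    let ?L = "{k + r * x | k r. k \<in> P \<and> r \<in> A}"
    have "?L \<in> \<S>" using ideal_of_adjoin[OF A Pi(1) x(1)] Pi(2) neg unfolding \<S>_def by blast
    from max[OF this] show False using ideal_of_adjoin(2,3)[OF A Pi(1) x(1)] x(2) by blast
  qed
  have "x \<in> P \<or> y \<in> P" if xy: "x \<in> A" "y \<in> A" "x * y \<in> P" for x y
  proof (rule ccontr)
    assume "\<not> ?thesis"
    then obtain k r l s where *: "k \<in> P" "r \<in> A" "k + r * x \<in> S" "l \<in> P" "s \<in> A" "l + s * y \<in> S"
      using meets xy by metis
    have "(k + r * x) * (l + s * y) = (l + s * y) * k + ((r * x) * l + (r * s) * (x * y))"
      by (simp add: algebra_simps)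
    moreover have "l + s * y \<in> A" "r * x \<in> A" "r * s \<in> A"
      using * xy A S unfolding subring_def by auto
    ultimately have "(k + r * x) * (l + s * y) \<in> P"
      using * xy Pi(1) unfolding ideal_of_def by auto
    thus False using S(3)[OF *(3,6)] Pi(3) by blast
  qed
  hence "prime_of A P" using Pi S(2) unfolding prime_of_def by blast
  thus ?thesis using that Pi by blast
qed

text \<open>The radical is the intersection of the primes above \<open>K\<close>: if no power of
  \<open>x\<close> were in \<open>K\<close>, a prime above \<open>K\<close> avoiding all these
  powers would contradict \<open>primes\<close>.\<close>

lemma power_mem_of_primes:
  assumes A: "subring A" and K: "ideal_of A K" and x: "x \<in> A"
    and primes: "\<And>P. prime_of A P \<Longrightarrow> K \<subseteq> P \<Longrightarrow> x \<in> P"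
  shows "\<exists>n. x ^ n \<in> K"
proof (rule ccontr)
  assume neg: "\<not> ?thesis"
  obtain P where "prime_of A P" "K \<subseteq> P" "P \<inter> range (\<lambda>n. x ^ n) = {}"
  proof (rule prime_of_avoiding[OF A K, of "range (\<lambda>n. x ^ n)"])
    show "range (\<lambda>n. x ^ n) \<subseteq> A" using subring_power[OF A x] by blast
    show "1 \<in> range (\<lambda>n. x ^ n)" by (metis power_0 rangeI)
    show "u * v \<in> range (\<lambda>n. x ^ n)" if "u \<in> range (\<lambda>n. x ^ n)" "v \<in> range (\<lambda>n. x ^ n)" for u v
      using that by (auto simp: power_add[symmetric])
    show "K \<inter> range (\<lambda>n. x ^ n) = {}" using neg by auto
  qed
  moreover have "x = x ^ 1" by simp
  ultimately show False using primes by blast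
qed
section \<open>Noetherian local rings\<close>

text \<open>The union of a chain of ideals is finitely generated, so one member of the chain
  contains the generators and equals the union; hence Zorn's lemma applies to any family.\<close>

lemma noetherian_maximal:
  fixes \<C> :: "'a::comm_ring_1 set set"
  assumes noeth: "noetherian TYPE('a)" and ideals: "\<And>K. K \<in> \<C> \<Longrightarrow> is_ideal K" and ne: "\<C> \<noteq> {}"
  shows "\<exists>P\<in>\<C>. \<forall>X\<in>\<C>. P \<subseteq> X \<longrightarrow> X = P"
proof (rule subset_Zorn_nonempty[OF ne])
    fix C assume C: "C \<noteq> {}" "subset.chain \<C> C"
    have CS: "is_ideal L" if "L \<in> C" for L
      using C(2) that ideals unfolding subset.chain_def by auto
    have "x + y \<in> \<Union>C" if xy: "x \<in> \<Union>C" "y \<in> \<Union>C" for x y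
    proof -
      obtain X Y where XY: "X \<in> C" "x \<in> X" "Y \<in> C" "y \<in> Y" using xy by blast
      hence "X \<subseteq> Y \<or> Y \<subseteq> X" using C(2) unfolding subset.chain_def by blast
      thus ?thesis using XY CS ideal_add[of X x y] ideal_add[of Y x y] by blast
    qed
    moreover have "0 \<in> \<Union>C" using C(1) CS ideal_0 by blast
    ultimately have "is_ideal (\<Union>C)" by (intro is_idealI) (auto intro: ideal_mult CS)
    then obtain F where F: "finite F" "\<Union>C = ideal_gen F" using noeth unfolding noetherian_def by blast
    have "F \<subseteq> \<Union>C" unfolding F(2) by (rule ideal_gen_superset)
    then obtain L where L: "L \<in> C" "F \<subseteq> L" using finite_subset_Union_chain[OF F(1)] C by metis
    have "\<Union>C = L" using L F(2) ideal_gen_least[OF CS[OF L(1)] L(2)] by blast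
    thus "\<Union>C \<in> \<C>" using L(1) C(2) unfolding subset.chain_def by auto
qed

lemma local_ring_unit:
  assumes "local_ring m" "r \<notin> m"
  obtains s where "s * r = 1"
proof -
  have "is_ideal ((*) r ` UNIV)" by (rule is_ideal_scale[OF is_ideal_UNIV])
  moreover have "r \<in> (*) r ` UNIV" by (intro image_eqI[of _ _ 1]) auto
  ultimately have "(*) r ` UNIV = UNIV" using assms unfolding local_ring_def by blast
  then obtain s where "1 = r * s" by blast
  thus ?thesis using that[of s] by (simp add: mult.commute)
qed

text \<open>Noetherian maximality takes the place of generators of \<open>M\<close>: if X is maximal
  among the ideals that contain \<open>L\<close> but not \<open>M\<close>, any y in \<open>M\<close>
  outside X gives M \<subseteq> X + Ry, so y - ay lies in X for some a in m, and 1 - a is a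
  unit.\<close>

lemma nakayama:
  fixes m :: "'a::comm_ring_1 set"
  assumes noeth: "noetherian TYPE('a)" and loc: "local_ring m" and L: "is_ideal L" and M: "is_ideal M"
    and sub: "\<And>x. x \<in> M \<Longrightarrow> \<exists>l\<in>L. \<exists>a\<in>ideal_prod m M. x = l + a"
  shows "M \<subseteq> L"
proof (rule ccontr)
  assume notsub: "\<not> M \<subseteq> L"
  let ?C = "{K. is_ideal K \<and> L \<subseteq> K \<and> \<not> M \<subseteq> K}"
  have "?C \<noteq> {}" using L notsub by blast
  hence "\<exists>X\<in>?C. \<forall>K\<in>?C. X \<subseteq> K \<longrightarrow> K = X" by (intro noetherian_maximal[OF noeth]) simp_all
  then obtain X where XC: "X \<in> ?C" and max': "\<forall>K\<in>?C. X \<subseteq> K \<longrightarrow> K = X" ..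
  have X: "is_ideal X" "L \<subseteq> X" "\<not> M \<subseteq> X" using XC by auto
  have max: "K = X" if "is_ideal K" "X \<subseteq> K" "\<not> M \<subseteq> K" for K
    using max'[rule_format, of K] that X(2) by auto
  obtain y where y: "y \<in> M" "y \<notin> X" using X(3) by blast
  have m: "is_ideal m" "m \<noteq> UNIV" using loc unfolding local_ring_def by auto
  have "M \<subseteq> adjoin X y"
    using max[OF is_ideal_adjoin[OF X(1)] adjoin_superset, of y] adjoin_mem[OF X(1), of y] y(2) by blast
  have "ideal_prod m M \<subseteq> {x + a * y | x a. x \<in> X \<and> a \<in> m}" (is "_ \<subseteq> ?V")
  proof (rule ideal_prod_least)
    have "0 + 0 * y \<in> ?V" using ideal_0[OF X(1)] ideal_0[OF m(1)] by blast
    moreover have "(x + a * y) + (x' + a' * y) \<in> ?V" if "x \<in> X" "a \<in> m" "x' \<in> X" "a' \<in> m" for x a x' a'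
    proof -
      have "(x + a * y) + (x' + a' * y) = (x + x') + (a + a') * y" by (simp add: algebra_simps)
      thus ?thesis using that ideal_add[OF X(1)] ideal_add[OF m(1)] by blast
    qed
    moreover have "r * (x + a * y) \<in> ?V" if "x \<in> X" "a \<in> m" for r x a
    proof -
      have "r * (x + a * y) = r * x + (r * a) * y" by (simp add: algebra_simps)
      thus ?thesis using that ideal_mult[OF X(1)] ideal_mult[OF m(1)] by blast
    qed
    ultimately show "is_ideal ?V" by (intro is_idealI) auto
  next
    fix a b assume a: "a \<in> m" and "b \<in> M"
    then obtain x r where x: "x \<in> X" "b = x + r * y" using \<open>M \<subseteq> adjoin X y\<close> unfolding adjoin_def by blast
    have "a * b = a * x + (a * r) * y" by (simp add: x algebra_simps)
    thus "a * b \<in> ?V" using ideal_mult[OF X(1) x(1)] ideal_mult2[OF m(1) a] by blast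
  qed
  moreover obtain l z where l0: "l \<in> L" "z \<in> ideal_prod m M" "y = l + z" using sub[OF y(1)] by blast
  ultimately obtain x a where l: "x \<in> X" "a \<in> m" "z = x + a * y" by blast
  have "(1 - a) * y = y - a * y" by (simp add: algebra_simps)
  also have "\<dots> = l + x" using l0(3) l(3) by (simp add: algebra_simps)
  finally have inX: "(1 - a) * y \<in> X" using l0(1) l(1) X(1,2) ideal_add by auto
  have "1 - a \<notin> m" using ideal_add[OF m(1) _ l(2), of "1 - a"] ideal_UNIV_iff[OF m(1)] m(2) by auto
  then obtain s where "s * (1 - a) = 1" using local_ring_unit[OF loc] by blast
  hence "s * ((1 - a) * y) = y" by (simp add: mult.assoc[symmetric])
  thus False using ideal_mult[OF X(1) inX, of s] y(2) by simp
qed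

section \<open>Lengths\<close>

text \<open>For ideals \<open>L\<close> inside \<open>M\<close> this bounds the length of M/L. The
  number \<open>k\<close> counts strict inclusions, and a chain need not start at \<open>L\<close>
  or end at \<open>M\<close>.\<close>

definition length_le :: "'a::comm_ring_1 set \<Rightarrow> 'a set \<Rightarrow> nat \<Rightarrow> bool" where
  "length_le L M e \<longleftrightarrow> (\<forall>N k. (\<forall>i\<le>k. is_ideal (N i) \<and> L \<subseteq> N i \<and> N i \<subseteq> M)
     \<and> (\<forall>i<k. N i \<subset> N (Suc i)) \<longrightarrow> k \<le> e)"

text \<open>The modular law: the last two assumptions amount to equal intersections and equal sums
  with \<open>X\<close>.\<close>

lemma ideal_modular_eq:
  assumes "is_ideal K" "is_ideal L" "K \<subseteq> L" "K \<inter> X = L \<inter> X"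
    and "\<And>l. l \<in> L \<Longrightarrow> \<exists>k\<in>K. \<exists>x\<in>X. l = k + x"
  shows "K = L"
proof
  show "L \<subseteq> K"
  proof
    fix l assume l: "l \<in> L"
    then obtain k x where kx: "k \<in> K" "x \<in> X" "l = k + x" using assms(5) by blast
    have "x = l - k" using kx by simp
    hence "x \<in> L" using ideal_diff[OF assms(2) l, of k] kx assms(3) by blast
    thus "l \<in> K" using kx assms(1,4) ideal_add by blast
  qed
qed (rule assms)

definition ideal_plus :: "'a::comm_ring_1 set \<Rightarrow> 'a set \<Rightarrow> 'a set" where
  "ideal_plus K L = {k + l | k l. k \<in> K \<and> l \<in> L}"

lemma is_ideal_ideal_plus:
  assumes "is_ideal K" "is_ideal L" shows "is_ideal (ideal_plus K L)"
proof (rule is_idealI)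
  show "0 \<in> ideal_plus K L" using assms ideal_0 unfolding ideal_plus_def by force
  show "x + y \<in> ideal_plus K L" if xy: "x \<in> ideal_plus K L" "y \<in> ideal_plus K L" for x y
  proof -
    obtain a b c d where *: "a \<in> K" "b \<in> L" "x = a + b" "c \<in> K" "d \<in> L" "y = c + d"
      using xy unfolding ideal_plus_def by blast
    have "x + y = (a + c) + (b + d)" using * by simp
    thus ?thesis using * assms ideal_add unfolding ideal_plus_def by blast
  qed
  show "r * x \<in> ideal_plus K L" if "x \<in> ideal_plus K L" for r x
    using that assms ideal_mult unfolding ideal_plus_def by (force simp: distrib_left)
qed

text \<open>Deleting repetitions leaves a strict chain of the counted length. Chains with
  repetitions arise when a strict chain is intersected with, or added to, a fixed ideal.\<close>

lemma length_le_weak_chain: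
  assumes "length_le L M e"
  shows "\<lbrakk>\<And>i. i \<le> k \<Longrightarrow> is_ideal (N i) \<and> L \<subseteq> N i \<and> N i \<subseteq> M; \<And>i. i < k \<Longrightarrow> N i \<subseteq> N (Suc i)\<rbrakk>
    \<Longrightarrow> card {i. i < k \<and> N i \<noteq> N (Suc i)} \<le> e"
proof -
  assume N: "\<And>i. i \<le> k \<Longrightarrow> is_ideal (N i) \<and> L \<subseteq> N i \<and> N i \<subseteq> M" and mono: "\<And>i. i < k \<Longrightarrow> N i \<subseteq> N (Suc i)"
  have "\<exists>l N'. N' l = N k \<and> l = card {i. i < k \<and> N i \<noteq> N (Suc i)}
      \<and> (\<forall>i\<le>l. is_ideal (N' i) \<and> L \<subseteq> N' i \<and> N' i \<subseteq> M) \<and> (\<forall>i<l. N' i \<subset> N' (Suc i))"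
    using N mono
  proof (induction k)
    case 0
    thus ?case by auto
  next
    case (Suc k)
    then obtain l N' where IH: "N' l = N k" "l = card {i. i < k \<and> N i \<noteq> N (Suc i)}"
      "\<forall>i\<le>l. is_ideal (N' i) \<and> L \<subseteq> N' i \<and> N' i \<subseteq> M" "\<forall>i<l. N' i \<subset> N' (Suc i)" by force
    show ?case
    proof (cases "N k = N (Suc k)")
      case True
      hence "{i. i < Suc k \<and> N i \<noteq> N (Suc i)} = {i. i < k \<and> N i \<noteq> N (Suc i)}" by (auto simp: less_Suc_eq)
      thus ?thesis using IH True by metis
    next
      case False
      hence "{i. i < Suc k \<and> N i \<noteq> N (Suc i)} = insert k {i. i < k \<and> N i \<noteq> N (Suc i)}" by (auto simp: less_Suc_eq)
      hence c: "card {i. i < Suc k \<and> N i \<noteq> N (Suc i)} = Suc l" by (simp add: IH(2))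
      have "N k \<subset> N (Suc k)" using Suc.prems(2)[of k] False by auto
      thus ?thesis unfolding c
        by (intro exI[of _ "Suc l"] exI[of _ "N'(Suc l := N (Suc k))"])
           (use IH Suc.prems(1)[of "Suc k"] in \<open>auto simp: less_Suc_eq le_Suc_eq\<close>)
    qed
  qed
  then obtain l N' where *: "l = card {i. i < k \<and> N i \<noteq> N (Suc i)}"
    "\<forall>i\<le>l. is_ideal (N' i) \<and> L \<subseteq> N' i \<and> N' i \<subseteq> M" "\<forall>i<l. N' i \<subset> N' (Suc i)" by blast
  have "l \<le> e" using assms[unfolded length_le_def, rule_format, of l N'] *(2,3) by simp
  thus ?thesis using *(1) by simp
qed

text \<open>At every step of a strict chain its intersection with \<open>X\<close> or its sum with
  \<open>X\<close> must grow, by the modular law; at most \<open>a\<close> steps are of the first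
  kind and at most \<open>b\<close> of the second.\<close>

lemma length_le_add:
  assumes X: "is_ideal X" "L \<subseteq> X" "X \<subseteq> M" and M: "is_ideal M"
    and a: "length_le L X a" and b: "length_le X M b"
  shows "length_le L M (a + b)"
  unfolding length_le_def
proof safe
  fix N :: "nat \<Rightarrow> 'a set" and k
  assume N: "\<forall>i\<le>k. is_ideal (N i) \<and> L \<subseteq> N i \<and> N i \<subseteq> M" and strict: "\<forall>i<k. N i \<subset> N (Suc i)"
  define U where "U i = N i \<inter> X" for i
  define W where "W i = ideal_plus (N i) X" for i
  have "card {i. i < k \<and> U i \<noteq> U (Suc i)} \<le> a"
  proof (rule length_le_weak_chain[OF a])
    fix i assume "i \<le> k" thus "is_ideal (U i) \<and> L \<subseteq> U i \<and> U i \<subseteq> X"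
      using N X is_ideal_Inter[of "{N i, X}"] unfolding U_def by auto
  qed (use strict in \<open>auto simp: U_def\<close>)
  moreover have "card {i. i < k \<and> W i \<noteq> W (Suc i)} \<le> b"
  proof (rule length_le_weak_chain[OF b])
    fix i assume i: "i \<le> k"
    have "X \<subseteq> W i" using ideal_0[of "N i"] N i unfolding W_def ideal_plus_def by force
    thus "is_ideal (W i) \<and> X \<subseteq> W i \<and> W i \<subseteq> M"
      using N X i M is_ideal_ideal_plus[of "N i" X] ideal_add[OF M] unfolding W_def ideal_plus_def by blast
  qed (use strict in \<open>auto simp: W_def ideal_plus_def\<close>)
  moreover have "{..<k} \<subseteq> {i. i < k \<and> U i \<noteq> U (Suc i)} \<union> {i. i < k \<and> W i \<noteq> W (Suc i)}"
  proof
    fix i assume i: "i \<in> {..<k}"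
    have "N i = N (Suc i)" if eq: "U i = U (Suc i)" "W i = W (Suc i)"
    proof (rule ideal_modular_eq[of _ _ X])
      fix l assume "l \<in> N (Suc i)"
      hence "l + 0 \<in> W (Suc i)" using ideal_0[OF X(1)] unfolding W_def ideal_plus_def by blast
      hence "l + 0 \<in> W i" by (simp only: eq(2))
      thus "\<exists>k\<in>N i. \<exists>x\<in>X. l = k + x" unfolding W_def ideal_plus_def by auto
    qed (use N strict i eq in \<open>auto simp: U_def\<close>)
    thus "i \<in> {i. i < k \<and> U i \<noteq> U (Suc i)} \<union> {i. i < k \<and> W i \<noteq> W (Suc i)}" using strict i by blast
  qed
  hence "card {..<k} \<le> card ({i. i < k \<and> U i \<noteq> U (Suc i)} \<union> {i. i < k \<and> W i \<noteq> W (Suc i)})"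
    by (intro card_mono) auto
  ultimately show "k \<le> a + b"
    using card_Un_le[of "{i. i < k \<and> U i \<noteq> U (Suc i)}" "{i. i < k \<and> W i \<noteq> W (Suc i)}"] by simp
qed

text \<open>Multiplication by \<open>x\<close> maps R onto xR, so a strict chain between xM and xR
  pulls back to a strict chain above \<open>M\<close>.\<close>

lemma length_le_scale:
  assumes M: "length_le M UNIV f" and x: "nzd x"
  shows "length_le ((*) x ` M) ((*) x ` UNIV) f"
  unfolding length_le_def
proof safe
  fix N :: "nat \<Rightarrow> 'a set" and k
  assume N: "\<forall>i\<le>k. is_ideal (N i) \<and> (*) x ` M \<subseteq> N i \<and> N i \<subseteq> (*) x ` UNIV"
    and strict: "\<forall>i<k. N i \<subset> N (Suc i)"
  have "is_ideal {a. a * x \<in> N i} \<and> M \<subseteq> {a. a * x \<in> N i} \<and> {a. a * x \<in> N i} \<subseteq> UNIV" if "i \<le> k" for i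
    using N that is_ideal_colon[of "N i" x] by (auto simp: mult.commute)
  moreover have "{a. a * x \<in> N i} \<subset> {a. a * x \<in> N (Suc i)}" if "i < k" for i
  proof -
    obtain y where y: "y \<in> N (Suc i)" "y \<notin> N i" using strict \<open>i < k\<close> by blast
    have "N (Suc i) \<subseteq> (*) x ` UNIV" using N \<open>i < k\<close> by auto
    then obtain a where "y = a * x" using y(1) by (auto simp: mult.commute)
    thus ?thesis using y strict \<open>i < k\<close> by auto
  qed
  ultimately show "k \<le> f" using M[unfolded length_le_def, rule_format, of k "\<lambda>i. {a. a * x \<in> N i}"] by simp
qed

text \<open>The quotient (K + Ry)/K is an image of R/m, hence simple or zero.\<close>

lemma length_le_adjoin:
  assumes loc: "local_ring m" and K: "is_ideal K" and y: "\<And>a. a \<in> m \<Longrightarrow> a * y \<in> K"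
  shows "length_le K (adjoin K y) 1"
  unfolding length_le_def
proof safe
  fix N :: "nat \<Rightarrow> 'a set" and k
  assume N: "\<forall>i\<le>k. is_ideal (N i) \<and> K \<subseteq> N i \<and> N i \<subseteq> adjoin K y" and strict: "\<forall>i<k. N i \<subset> N (Suc i)"
  have *: "X = adjoin K y" if X: "is_ideal X" "K \<subset> X" "X \<subseteq> adjoin K y" for X
  proof -
    obtain u where u: "u \<in> X" "u \<notin> K" using X by blast
    then obtain a r where a: "a \<in> K" "u = a + r * y" using X unfolding adjoin_def by blast
    have "r \<notin> m" using u a y ideal_add[OF K] by blast
    then obtain s where s: "s * r = 1" using local_ring_unit[OF loc] by blast
    have "r * y = u - a" using a by simp
    hence "r * y \<in> X" using ideal_diff[OF X(1) u(1), of a] a(1) X(2) by auto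
    hence "s * (r * y) \<in> X" by (rule ideal_mult[OF X(1)])
    hence "y \<in> X" by (simp add: mult.assoc[symmetric] s)
    thus ?thesis using adjoin_least[of X K y] X by blast
  qed
  show "k \<le> 1"
  proof (rule ccontr)
    assume "\<not> k \<le> 1"
    hence "N 0 \<subset> N 1" "N 1 \<subset> N 2" "1 \<le> k" "2 \<le> k" "0 \<le> k" using strict by (auto simp: numeral_2_eq_2)
    thus False using *[of "N 1"] N by blast
  qed
qed

section \<open>Finite colength in dimension one\<close>

text \<open>Localising at \<open>P\<close> and inverting \<open>s\<close> leaves a nonzero ring, so
  \<open>P\<close> contains a strictly smaller prime without \<open>s\<close>. If \<open>P\<close>
  were not \<open>m\<close>, these two primes and \<open>m\<close> would form a chain with two
  strict inclusions.\<close>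

lemma prime_containing_nzd:
  fixes m :: "'a::comm_ring_1 set"
  assumes loc: "local_ring m" and dim: "krull_dim TYPE('a) = 1" and P: "prime_ideal P" and s: "nzd s" "s \<in> P"
  shows "P = m"
proof (rule ccontr)
  assume "P \<noteq> m"
  have Pi: "is_ideal P" "P \<noteq> UNIV" using P unfolding prime_ideal_def by auto
  hence "P \<subset> m" using loc \<open>P \<noteq> m\<close> unfolding local_ring_def by blast
  have "prime_ideal m" unfolding prime_ideal_def
  proof (intro conjI allI impI)
    show "is_ideal m" "m \<noteq> UNIV" using loc unfolding local_ring_def by auto
    fix x y assume xy: "x * y \<in> m"
    show "x \<in> m \<or> y \<in> m"
    proof (rule ccontr)
      assume neg: "\<not> ?thesis"
      then obtain t where "t * x = 1" using local_ring_unit[OF loc] by blast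
      hence "y = t * (x * y)" by (simp add: mult.assoc[symmetric])
      thus False using ideal_mult[OF \<open>is_ideal m\<close> xy, of t] neg by simp
    qed
  qed
  \<comment> \<open>The primes disjoint from \<open>?S\<close> are those inside \<open>P\<close>
    that do not contain \<open>s\<close>; \<open>?S\<close> omits 0 because \<open>s\<close> is a
    nonzerodivisor and 0 lies in \<open>P\<close>.\<close>
  let ?S = "{s ^ n * t | n t. t \<notin> P}"
  have t: "x * y \<notin> P" if "x \<notin> P" "y \<notin> P" for x y using P that unfolding prime_ideal_def by blast
  obtain P' where P': "prime_of UNIV P'" "{0} \<subseteq> P'" "P' \<inter> ?S = {}"
  proof (rule prime_of_avoiding[OF subring_UNIV, of "{0}" ?S])
    show "ideal_of UNIV {0}" unfolding ideal_of_def by auto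
    have "s ^ 0 * 1 \<in> ?S" using ideal_UNIV_iff[OF Pi(1)] Pi(2) by blast
    thus "1 \<in> ?S" by simp
    show "x * y \<in> ?S" if xy: "x \<in> ?S" "y \<in> ?S" for x y
    proof -
      obtain n a l b where "a \<notin> P" "b \<notin> P" "x = s ^ n * a" "y = s ^ l * b" using xy by blast
      moreover from this have "x * y = s ^ (n + l) * (a * b)" by (simp add: power_add ac_simps)
      ultimately show ?thesis using t by blast
    qed
    have "s ^ n * a = 0 \<Longrightarrow> a = 0" for n a using s(1) by (induction n) (auto simp: nzd_def mult.assoc)
    thus "{0} \<inter> ?S = {}" using ideal_0[OF Pi(1)] by auto
  qed auto
  have "P' \<subseteq> P"
  proof
    fix x assume "x \<in> P'" hence "s ^ 0 * x \<notin> ?S" using P' by auto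
    thus "x \<in> P" by blast
  qed
  moreover have "s ^ 1 * 1 \<in> ?S" using ideal_UNIV_iff[OF Pi(1)] Pi(2) by blast
  hence "s \<notin> P'" using P' by auto
  ultimately have "P' \<subset> P" using s by blast
  define C where "C i = (if i = 0 then P' else if i = 1 then P else m)" for i :: nat
  have "\<forall>i\<le>2. prime_ideal (C i)" using P' P \<open>prime_ideal m\<close> by (auto simp: C_def prime_of_UNIV)
  moreover have "\<forall>i<2. C i \<subset> C (Suc i)" using \<open>P' \<subset> P\<close> \<open>P \<subset> m\<close> by (auto simp: C_def less_2_cases_iff)
  ultimately have "enat 2 \<le> krull_dim TYPE('a)" unfolding krull_dim_def by (intro Sup_upper) blast
  thus False using dim by (simp add: one_enat_def)
qed

text \<open>Otherwise there is an ideal K of infinite colength all of whose proper enlargements have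
  finite colength. An associated prime of R/K contains \<open>s\<close>, hence is \<open>m\<close>,
  so some enlargement K + Ry has a simple quotient by K, and adding lengths gives K finite
  colength.\<close>

lemma finite_length:
  fixes m M :: "'a::comm_ring_1 set"
  assumes noeth: "noetherian TYPE('a)" and loc: "local_ring m" and dim: "krull_dim TYPE('a) = 1"
    and M: "is_ideal M" and s: "nzd s" "s \<in> M"
  shows "\<exists>f. length_le M UNIV f"
proof (rule ccontr)
  assume neg: "\<not> ?thesis"
  let ?C = "{K. is_ideal K \<and> M \<subseteq> K \<and> (\<nexists>f. length_le K UNIV f)}"
  have "?C \<noteq> {}" using neg M by blast
  hence "\<exists>K\<in>?C. \<forall>X\<in>?C. K \<subseteq> X \<longrightarrow> X = K" by (intro noetherian_maximal[OF noeth]) simp_all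
  then obtain K where KC: "K \<in> ?C" and Kmax': "\<forall>X\<in>?C. K \<subseteq> X \<longrightarrow> X = K" ..
  have K: "is_ideal K" "M \<subseteq> K" "\<nexists>f. length_le K UNIV f" using KC by auto
  have Kmax: "X = K" if "is_ideal X" "K \<subseteq> X" "\<nexists>f. length_le X UNIV f" for X
    using Kmax'[rule_format, of X] that K(2) by auto
  have "length_le UNIV UNIV 0" unfolding length_le_def by (metis not_gr0 psubset_eq top.extremum_uniqueI zero_le le0)
  hence "K \<noteq> UNIV" using K(3) by blast
  \<comment> \<open>These are the annihilators of the nonzero elements of R/K; a maximal one is
    prime.\<close>
  let ?D = "{{a. a * y \<in> K} | y. y \<notin> K}"
  have "?D \<noteq> {}" using \<open>K \<noteq> UNIV\<close> by blast
  hence "\<exists>P\<in>?D. \<forall>X\<in>?D. P \<subseteq> X \<longrightarrow> X = P"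
    using is_ideal_colon[OF K(1)] by (intro noetherian_maximal[OF noeth]) blast+
  then obtain P where P: "P \<in> ?D" and Pmax: "\<forall>X\<in>?D. P \<subseteq> X \<longrightarrow> X = P" ..
  then obtain y where y: "y \<notin> K" "P = {a. a * y \<in> K}" by blast
  have "prime_ideal P" unfolding prime_ideal_def
  proof (intro conjI allI impI)
    show "is_ideal P" unfolding y(2) by (rule is_ideal_colon[OF K(1)])
    show "P \<noteq> UNIV" using y by (metis UNIV_I mem_Collect_eq mult_1)
    fix x x' assume xx: "x * x' \<in> P"
    show "x \<in> P \<or> x' \<in> P"
    proof (cases "x \<in> P")
      case False
      hence "x * y \<notin> K" using y by blast
      moreover have "a * (x * y) \<in> K" if "a \<in> P" for a
        using ideal_mult[OF K(1), of "a * y" x] that unfolding y(2) by (simp add: ac_simps)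
      hence "P \<subseteq> {a. a * (x * y) \<in> K}" by blast
      ultimately have "{a. a * (x * y) \<in> K} = P" using Pmax by blast
      thus ?thesis using xx y(2) by (auto simp: ac_simps)
    qed auto
  qed
  moreover have "s \<in> P" using s(2) K(2) ideal_mult2[OF K(1)] unfolding y(2) by blast
  ultimately have "P = m" using prime_containing_nzd[OF loc dim _ s(1)] by blast
  hence "length_le K (adjoin K y) 1" using y(2) by (intro length_le_adjoin[OF loc K(1)]) blast
  moreover have "adjoin K y \<noteq> K" using adjoin_mem[OF K(1), of y] y(1) by blast
  then obtain f where "length_le (adjoin K y) UNIV f"
    using Kmax[OF is_ideal_adjoin[OF K(1)] adjoin_superset] by blast
  ultimately have "length_le K UNIV (1 + f)"
    by (intro length_le_add[OF is_ideal_adjoin[OF K(1)] adjoin_superset _ is_ideal_UNIV]) auto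
  thus False using K(3) by blast
qed

text \<open>The length of \<open>M/xM\<close> equals that of \<open>R/xR\<close>, because \<open>R/M\<close> and \<open>xR/xM\<close> are isomorphic.\<close>

lemma length_le_self_scale:
  assumes M: "is_ideal M" and f: "length_le M UNIV f" and x: "nzd x" and e: "length_le ((*) x ` UNIV) UNIV e"
  shows "length_le ((*) x ` M) M e"
proof -
  \<comment> \<open>The exact length of R/M: its minimality produces a chain with \<open>f'\<close>
    strict inclusions above \<open>M\<close>, which is what allows \<open>f'\<close> to be cancelled
    at the end.\<close>
  define f' where "f' = (LEAST f. length_le M UNIV f)"
  have f': "length_le M UNIV f'" unfolding f'_def by (rule LeastI[of _ f]) (rule f)
  have "\<exists>N. (\<forall>i\<le>f'. is_ideal (N i) \<and> M \<subseteq> N i) \<and> (\<forall>i<f'. N i \<subset> N (Suc i))"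
  proof (cases f')
    case 0
    thus ?thesis using M by (intro exI[of _ "\<lambda>_. M"]) auto
  next
    case (Suc g)
    have "\<not> length_le M UNIV g" using not_less_Least[of g "length_le M UNIV"] Suc unfolding f'_def by simp
    then obtain N k where N: "\<forall>i\<le>k. is_ideal (N i) \<and> M \<subseteq> N i" "\<forall>i<k. N i \<subset> N (Suc i)" "\<not> k \<le> g"
      unfolding length_le_def by blast
    thus ?thesis using Suc by (intro exI[of _ N]) auto
  qed
  then obtain N where N: "\<forall>i\<le>f'. is_ideal (N i) \<and> M \<subseteq> N i" "\<forall>i<f'. N i \<subset> N (Suc i)" by blast
  have tot: "length_le ((*) x ` M) UNIV (f' + e)"
    by (rule length_le_add[OF is_ideal_scale[OF is_ideal_UNIV] _ _ is_ideal_UNIV length_le_scale[OF f' x] e]) auto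
  have xM: "(*) x ` M \<subseteq> M" using ideal_mult[OF M] by blast
  show ?thesis unfolding length_le_def
  proof safe
    fix L k assume L: "\<forall>i\<le>k. is_ideal (L i) \<and> (*) x ` M \<subseteq> L i \<and> L i \<subseteq> M" "\<forall>i<k. L i \<subset> L (Suc i)"
    \<comment> \<open>Splicing at index \<open>k\<close> replaces \<open>L k\<close> by
      \<open>N 0\<close>, which contains \<open>M\<close> and hence \<open>L k\<close>; no strict
      inclusion is lost.\<close>
    define C where "C i = (if i < k then L i else N (i - k))" for i
    have "\<forall>i\<le>k + f'. is_ideal (C i) \<and> (*) x ` M \<subseteq> C i \<and> C i \<subseteq> UNIV"
    proof (intro allI impI)
      fix i assume i: "i \<le> k + f'"
      show "is_ideal (C i) \<and> (*) x ` M \<subseteq> C i \<and> C i \<subseteq> UNIV"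
      proof (cases "i < k")
        case True
        thus ?thesis using L(1)[rule_format, of i] by (simp add: C_def)
      next
        case False
        hence "is_ideal (C i)" "M \<subseteq> C i" using N(1)[rule_format, of "i - k"] i by (simp_all add: C_def)
        thus ?thesis using subset_trans[OF xM] by simp
      qed
    qed
    moreover have "\<forall>i<k + f'. C i \<subset> C (Suc i)"
    proof (intro allI impI)
      fix i assume i: "i < k + f'"
      consider "Suc i < k" | "Suc i = k" | "i \<ge> k" by linarith
      thus "C i \<subset> C (Suc i)"
      proof cases
        case 1 thus ?thesis using L(2) by (simp add: C_def)
      next
        case 2
        hence "L i \<subset> L k" "L k \<subseteq> M" "M \<subseteq> N 0" using L N(1) by auto
        hence "L i \<subset> N 0" by blast
        thus ?thesis using 2 by (simp add: C_def)
      next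
        case 3 thus ?thesis using N(2) i by (simp add: C_def Suc_diff_le)
      qed
    qed
    ultimately have "k + f' \<le> f' + e" using tot unfolding length_le_def by blast
    thus "k \<le> e" by simp
  qed
qed

text \<open>Since xM \<subseteq> mM, the quotient M/mM has length at most \<open>e\<close>.
  Adjoining e + 1 elements to mM one at a time must therefore stall, and stalling at
  \<open>b i\<close> is the relation.\<close>

lemma relation_mod_maximal:
  fixes m :: "'a::comm_ring_1 set"
  assumes loc: "local_ring m" and M: "is_ideal M" and e: "length_le ((*) x ` M) M e" and x: "x \<in> m"
    and b: "\<And>i. i \<le> e \<Longrightarrow> b i \<in> M"
  shows "\<exists>i\<le>e. \<exists>r. b i - (\<Sum>j<i. r j * b j) \<in> ideal_prod m M"
proof -
  have m: "is_ideal m" using loc unfolding local_ring_def by auto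
  define N where "N i = rec_nat (ideal_prod m M) (\<lambda>i X. adjoin X (b i)) i" for i
  have N0: "N 0 = ideal_prod m M" and NS: "N (Suc i) = adjoin (N i) (b i)" for i by (simp_all add: N_def)
  have id: "is_ideal (N i)" for i
    by (induction i) (simp_all add: N0 NS is_ideal_ideal_prod m is_ideal_adjoin)
  have "ideal_prod m M \<subseteq> N i" for i
    by (induction i) (use adjoin_superset in \<open>auto simp: N0 NS\<close>)
  moreover have "(*) x ` M \<subseteq> ideal_prod m M" using x ideal_prodI by blast
  moreover have "N i \<subseteq> M" if "i \<le> Suc e" for i using that
  proof (induction i)
    case 0
    show ?case unfolding N0 by (rule ideal_prod_subset[OF M])
  next
    case (Suc i)
    thus ?case unfolding NS by (intro adjoin_least[OF M] b) simp_all
  qed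
  ultimately have "\<forall>i\<le>Suc e. is_ideal (N i) \<and> (*) x ` M \<subseteq> N i \<and> N i \<subseteq> M" using id by blast
  hence "\<not> (\<forall>i<Suc e. N i \<subset> N (Suc i))" using e unfolding length_le_def by (metis Suc_n_not_le_n)
  then obtain i where i: "i \<le> e" "b i \<in> N i"
    using adjoin_superset adjoin_mem[OF id] unfolding NS by (metis less_Suc_eq_le psubsetI)
  have "\<exists>r. y - (\<Sum>j<i. r j * b j) \<in> ideal_prod m M" if "y \<in> N i" for y i
    using that
  proof (induction i arbitrary: y)
    case (Suc i)
    then obtain z t where z: "z \<in> N i" "y = z + t * b i" unfolding NS adjoin_def by blast
    obtain r where r: "z - (\<Sum>j<i. r j * b j) \<in> ideal_prod m M" using Suc.IH[OF z(1)] by blast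
    show ?case by (rule exI[of _ "r(i := t)"]) (use r z in \<open>simp add: algebra_simps\<close>)
  qed (simp add: N0)
  thus ?thesis using i by blast
qed

text \<open>The terms below the first coefficient outside \<open>m\<close> already lie in mM and are
  dropped, so the relation begins with a unit coefficient. The order matters: when
  \<open>b j\<close> carries a factor c^j, splitting off c^i leaves a cofactor whose first term has
  no factor c and a unit coefficient.\<close>

lemma relation_with_unit:
  fixes m :: "'a::comm_ring_1 set"
  assumes loc: "local_ring m" and M: "is_ideal M" and e: "length_le ((*) x ` M) M e" and x: "x \<in> m"
    and b: "\<And>i. i \<le> e \<Longrightarrow> b i \<in> M"
  shows "\<exists>i\<le>e. \<exists>u. u i \<notin> m \<and> (\<Sum>j=i..e. u j * b j) \<in> ideal_prod m M"
proof -
  have m: "is_ideal m" "1 \<notin> m" using loc ideal_UNIV_iff unfolding local_ring_def by auto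
  have mM: "is_ideal (ideal_prod m M)" by (rule is_ideal_ideal_prod[OF m(1)])
  obtain k r where k: "k \<le> e" and r: "b k - (\<Sum>j<k. r j * b j) \<in> ideal_prod m M"
    using relation_mod_maximal[OF loc M e x, of b] b by blast
  define u where "u j = (if j < k then - r j else if j = k then 1 else 0)" for j
  have "(\<Sum>j\<le>e. u j * b j) = (\<Sum>j\<le>k. u j * b j)"
    using k by (intro sum.mono_neutral_right) (auto simp: u_def)
  also have "\<dots> = b k - (\<Sum>j<k. r j * b j)"
    by (simp add: lessThan_Suc_atMost[symmetric] u_def sum_negf)
  finally have all: "(\<Sum>j\<le>e. u j * b j) \<in> ideal_prod m M" using r by simp
  define i where "i = (LEAST j. u j \<notin> m)"
  have "u k \<notin> m" using m(2) by (simp add: u_def)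
  hence i: "u i \<notin> m" "i \<le> k" unfolding i_def by (rule LeastI, rule Least_le)
  have low: "(\<Sum>j<i. u j * b j) \<in> ideal_prod m M"
  proof (rule ideal_sum[OF mM])
    fix j assume "j \<in> {..<i}"
    hence "j < i" by simp
    hence "u j \<in> m" using not_less_Least[of j "\<lambda>j. u j \<notin> m"] unfolding i_def by blast
    thus "u j * b j \<in> ideal_prod m M" using b[of j] \<open>j < i\<close> i(2) k by (intro ideal_prodI) auto
  qed
  have "{..e} = {..<i} \<union> {i..e}" using i(2) k by auto
  hence "(\<Sum>j\<le>e. u j * b j) = (\<Sum>j<i. u j * b j) + (\<Sum>j=i..e. u j * b j)"
    by (simp add: sum.union_disjoint[symmetric] ivl_disj_int)
  hence "(\<Sum>j=i..e. u j * b j) = (\<Sum>j\<le>e. u j * b j) - (\<Sum>j<i. u j * b j)" by simp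
  thus ?thesis using ideal_diff[OF mM all low] i k by (intro exI[of _ i] conjI exI[of _ u]) auto
qed

section \<open>The Rees algebra\<close>

definition rees :: "'a::comm_ring_1 set \<Rightarrow> 'a poly set" where
  "rees I = {p. \<forall>n. coeff p n \<in> ideal_pow I n}"

text \<open>The ideal mR[It] of R[It], with the fibre ring of \<open>I\<close> as quotient.\<close>

definition rees_extension :: "'a::comm_ring_1 set \<Rightarrow> 'a set \<Rightarrow> 'a poly set" where
  "rees_extension m I = {p. \<forall>n. coeff p n \<in> ideal_prod m (ideal_pow I n)}"

lemma subring_rees:
  assumes I: "is_ideal I" shows "subring (rees I)"
proof -
  have "coeff (p * q) n \<in> ideal_pow I n" if "p \<in> rees I" "q \<in> rees I" for p q n
    unfolding coeff_mult
  proof (rule ideal_sum[OF is_ideal_ideal_pow[OF I]])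
    fix i assume "i \<in> {..n}"
    thus "coeff p i * coeff q (n - i) \<in> ideal_pow I n"
      using ideal_pow_mult[OF I, of "coeff p i" i "coeff q (n - i)" "n - i"] that by (simp add: rees_def)
  qed
  thus ?thesis
    using is_ideal_ideal_pow[OF I] unfolding subring_def
    by (auto simp: rees_def ideal_0 ideal_add ideal_uminus coeff_1)
qed

lemma ideal_pow_mult_maximal:
  assumes m: "is_ideal m" and I: "is_ideal I" and a: "a \<in> ideal_pow I p"
    and b: "b \<in> ideal_prod m (ideal_pow I q)"
  shows "a * b \<in> ideal_prod m (ideal_pow I (p + q))"
proof -
  have "ideal_prod m (ideal_pow I q) \<subseteq> {b. b * a \<in> ideal_prod m (ideal_pow I (p + q))}"
  proof (rule ideal_prod_least)
    show "is_ideal {b. b * a \<in> ideal_prod m (ideal_pow I (p + q))}"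
      by (intro is_ideal_colon is_ideal_ideal_prod m)
    show "x * y \<in> {b. b * a \<in> ideal_prod m (ideal_pow I (p + q))}" if "x \<in> m" "y \<in> ideal_pow I q" for x y
      using ideal_prodI[OF that(1) ideal_pow_mult[OF I a that(2)]] by (simp add: ac_simps)
  qed
  thus ?thesis using b by (auto simp: mult.commute)
qed

lemma ideal_of_rees_extension:
  assumes m: "is_ideal m" and I: "is_ideal I"
  shows "ideal_of (rees I) (rees_extension m I)"
proof -
  have mI: "is_ideal (ideal_prod m (ideal_pow I n))" for n by (rule is_ideal_ideal_prod[OF m])
  have "coeff (p * q) n \<in> ideal_prod m (ideal_pow I n)" if "p \<in> rees I" "q \<in> rees_extension m I" for p q n
    unfolding coeff_mult
  proof (rule ideal_sum[OF mI])
    fix i assume "i \<in> {..n}"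
    thus "coeff p i * coeff q (n - i) \<in> ideal_prod m (ideal_pow I n)"
      using ideal_pow_mult_maximal[OF m I, of "coeff p i" i "coeff q (n - i)" "n - i"] that
      by (simp add: rees_def rees_extension_def)
  qed
  moreover have "rees_extension m I \<subseteq> rees I"
    using ideal_prod_subset[OF is_ideal_ideal_pow[OF I]] unfolding rees_def rees_extension_def by blast
  ultimately show ?thesis using mI unfolding ideal_of_def
    by (auto simp: rees_extension_def ideal_0 ideal_add)
qed

lemma monom_rees: "is_ideal I \<Longrightarrow> c \<in> ideal_pow I n \<Longrightarrow> monom c n \<in> rees I"
  by (auto simp: rees_def ideal_0 is_ideal_ideal_pow)

lemma monom_rees_extension:
  "is_ideal m \<Longrightarrow> c \<in> ideal_prod m (ideal_pow I n) \<Longrightarrow> monom c n \<in> rees_extension m I"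
  by (auto simp: rees_extension_def ideal_0 is_ideal_ideal_prod)

lemma monom_sum: "monom (\<Sum>i\<in>S. f i) n = (\<Sum>i\<in>S. monom (f i) n)"
  by (rule poly_eqI) (simp add: coeff_sum)

lemma subring_sum: "subring A \<Longrightarrow> (\<And>i. i \<in> S \<Longrightarrow> f i \<in> A) \<Longrightarrow> sum f S \<in> A"
  by (induction S rule: infinite_finite_induct) (auto simp: subring_def)

text \<open>Read membership in \<open>P\<close> as vanishing. Where \<open>C\<close> vanishes, so
  does \<open>D\<close>, and \<open>F\<close> is a unit times \<open>T ^ n\<close>, so the
  combination vanishes exactly when \<open>T\<close> does. Where \<open>C\<close> does not vanish,
  \<open>C ^ i * F\<close> forces \<open>F\<close> to vanish, and the combination reduces to
  \<open>D\<close>, which does not vanish there. Positivity of \<open>k\<close> keeps the factor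
  \<open>T\<close> even for \<open>n = 0\<close>.\<close>

lemma prime_of_combination:
  assumes A: "subring A" and P: "prime_of A P"
    and mem: "C \<in> A" "T \<in> A" "G \<in> A" "U \<in> A" "V \<in> A" and VU: "V * U = 1"
    and F: "F = U * T ^ n + C * G" "C ^ i * F \<in> P" and k: "0 < k"
    and C: "C \<in> P \<longleftrightarrow> S" and D: "D \<in> P \<longleftrightarrow> S"
  shows "D + T ^ k * F \<in> P \<longleftrightarrow> S \<and> T \<in> P"
proof -
  have Pa: "x + y \<in> P" if "x \<in> P" "y \<in> P" for x y using P that unfolding prime_of_def ideal_of_def by blast
  have Pm: "x * y \<in> P" if "x \<in> A" "y \<in> P" for x y using P that unfolding prime_of_def ideal_of_def by blast
  have Pp: "x \<in> P \<or> y \<in> P" if "x \<in> A" "y \<in> A" "x * y \<in> P" for x y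
    using P that unfolding prime_of_def by blast
  have "-1 \<in> A" using A unfolding subring_def by simp
  have Pc: "y \<in> P" if "x + y \<in> P" "x \<in> P" for x y
    using Pa[OF that(1) Pm[OF \<open>-1 \<in> A\<close> that(2)]] by simp
  have Am: "x * y \<in> A" if "x \<in> A" "y \<in> A" for x y using A that unfolding subring_def by blast
  have pow: "x ^ l \<in> A" if "x \<in> A" for x l by (rule subring_power[OF A that])
  have Aa: "x + y \<in> A" if "x \<in> A" "y \<in> A" for x y using A that unfolding subring_def by blast
  have FA: "F \<in> A" unfolding F(1) by (intro Aa Am pow mem)
  show ?thesis
  proof
    assume q: "D + T ^ k * F \<in> P"
    show "S \<and> T \<in> P"
    proof (cases "C \<in> P")
      case True
      hence "T ^ k * F \<in> P" using q C D Pc by blast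
      moreover have "T ^ k * F = (T ^ k * G) * C + U * T ^ (k + n)" unfolding F(1) by (simp add: algebra_simps power_add)
      ultimately have "(T ^ k * G) * C + U * T ^ (k + n) \<in> P" by simp
      hence "U * T ^ (k + n) \<in> P" by (rule Pc) (intro Pm Am pow mem True)
      hence "V * (U * T ^ (k + n)) \<in> P" by (rule Pm[OF mem(5)])
      hence "T ^ (k + n) \<in> P" by (simp add: mult.assoc[symmetric] VU)
      thus ?thesis using prime_of_power[OF P A mem(2)] True C by blast
    next
      case False
      hence "C ^ i \<notin> P" using prime_of_power[OF P A mem(1)] by blast
      hence "F \<in> P" using Pp[OF pow[OF mem(1)] FA F(2)] by blast
      hence "T ^ k * F \<in> P" by (intro Pm pow mem)
      moreover have "T ^ k * F + D \<in> P" using q by (simp add: add.commute)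
      ultimately have "D \<in> P" using Pc by blast
      thus ?thesis using C D False by blast
    qed
  next
    assume S: "S \<and> T \<in> P"
    obtain l where "k = Suc l" using k by (cases k) auto
    hence "T ^ k * F = (T ^ l * F) * T" by (simp add: ac_simps)
    moreover have "(T ^ l * F) * T \<in> P" using S by (intro Pm Am pow mem FA) auto
    ultimately show "D + T ^ k * F \<in> P" using S D Pa by simp
  qed
qed

text \<open>On the spectrum of the fibre ring, ct^d has the same zero set as all the gt with g in
  \<open>G\<close> together. For \<open>G\<close> generating \<open>I\<close>, ct^d thus has the
  radical of the irrelevant ideal modulo mR[It]. The degree is a parameter so that it can be
  prescribed.\<close>

definition detects :: "'a::comm_ring_1 set \<Rightarrow> 'a set \<Rightarrow> 'a set \<Rightarrow> 'a \<Rightarrow> nat \<Rightarrow> bool" where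
  "detects m I G c d \<longleftrightarrow> c \<in> ideal_pow I d \<and> (\<forall>P. prime_of (rees I) P \<longrightarrow> rees_extension m I \<subseteq> P \<longrightarrow>
     (monom c d \<in> P \<longleftrightarrow> (\<forall>g\<in>G. monom g 1 \<in> P)))"

text \<open>A relation between \<open>c\<^sup>i g\<^bsup>d(e-i)\<^esup>\<close>, \<open>i \<le> e\<close>, modulo \<open>m\<close> with a unit coefficient exists because
  the fibre ring has dimension at most one; after splitting off the power of \<open>c\<close> in it, the cofactor
  \<open>F\<close> is \<open>u g\<^bsup>dr\<^esup> + c(\<dots>)\<close> with \<open>u\<close> a unit, and it vanishes wherever \<open>c\<close> does not.
  This replaces prime avoidance, which fails for a finite residue field.\<close>

lemma detects_insert:
  fixes m I :: "'a::comm_ring_1 set"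
  assumes loc: "local_ring m" and I: "is_ideal I" and x: "x \<in> m" and g: "g \<in> I"
    and e: "\<And>n. length_le ((*) x ` ideal_pow I n) (ideal_pow I n) e"
    and G: "\<And>d. d \<ge> d0 \<Longrightarrow> \<exists>c. detects m I G c d"
  shows "\<exists>d1. \<forall>d\<ge>d1. \<exists>c. detects m I (insert g G) c d"
proof -
  have m: "is_ideal m" using loc unfolding local_ring_def by auto
  note A = subring_rees[OF I]
  obtain c where c: "detects m I G c d0" using G by blast
  have cI: "c \<in> ideal_pow I d0" using c unfolding detects_def by blast
  have gI: "g ^ n \<in> ideal_pow I n" for n
    using ideal_pow_power[OF I, of g 1 n] ideal_pow_1[OF I] g by simp
  have cg: "c ^ j * g ^ (d0 * (e - j)) \<in> ideal_pow I (d0 * e)" if "j \<le> e" for j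
  proof -
    have "d0 * j + d0 * (e - j) = d0 * e" using that by (simp add: distrib_left[symmetric])
    thus ?thesis using ideal_pow_mult[OF I ideal_pow_power[OF I cI, of j] gI[of "d0 * (e - j)"]] by simp
  qed
  \<comment> \<open>The e + 1 elements share the degree \<open>d0 * e\<close>, so they lie in one
    power of \<open>I\<close>, where the length bound forces a relation.\<close>
  obtain i u where i: "i \<le> e" "u i \<notin> m"
    and rel: "(\<Sum>j=i..e. u j * (c ^ j * g ^ (d0 * (e - j)))) \<in> ideal_prod m (ideal_pow I (d0 * e))"
    using relation_with_unit[OF loc is_ideal_ideal_pow[OF I] e x, of "\<lambda>j. c ^ j * g ^ (d0 * (e - j))" "d0 * e"] cg
    by blast
  obtain v where v: "v * u i = 1" using local_ring_unit[OF loc i(2)] by blast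
  define C where "C = monom c d0"
  define T where "T = monom g 1"
  \<comment> \<open>\<open>F\<close> is the relation with \<open>C ^ i\<close> split off,
    homogeneous with coefficient \<open>f\<close>; \<open>G'\<close> collects its terms beyond the
    first, each with one more factor \<open>C\<close> removed.\<close>
  define G' where "G' = (\<Sum>j=Suc i..e. monom (u j) 0 * C ^ (j - Suc i) * T ^ (d0 * (e - j)))"
  define F where "F = (\<Sum>j=i..e. monom (u j) 0 * C ^ (j - i) * T ^ (d0 * (e - j)))"
  define f where "f = (\<Sum>j=i..e. u j * c ^ (j - i) * g ^ (d0 * (e - j)))"
  have CA: "C \<in> rees I" and TA: "T \<in> rees I"
    unfolding C_def T_def using cI g ideal_pow_1[OF I] by (auto intro!: monom_rees I)
  have constA: "monom a 0 \<in> rees I" for a by (rule monom_rees[OF I]) simp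
  have Am: "p * q \<in> rees I" if "p \<in> rees I" "q \<in> rees I" for p q using A that unfolding subring_def by blast
  have GA: "G' \<in> rees I" unfolding G'_def
    by (intro subring_sum[OF A] Am constA subring_power[OF A] CA TA)
  have C_pow: "C ^ k = monom (c ^ k) (d0 * k)" for k by (simp add: C_def monom_power mult.commute)
  have T_pow: "T ^ k = monom (g ^ k) k" for k by (simp add: T_def monom_power)
  have F1: "F = monom (u i) 0 * T ^ (d0 * (e - i)) + C * G'"
  proof -
    have "F = monom (u i) 0 * C ^ (i - i) * T ^ (d0 * (e - i)) + (\<Sum>j=Suc i..e. monom (u j) 0 * C ^ (j - i) * T ^ (d0 * (e - j)))"
      unfolding F_def by (rule sum.atLeast_Suc_atMost[OF i(1)])
    moreover have "(\<Sum>j=Suc i..e. monom (u j) 0 * C ^ (j - i) * T ^ (d0 * (e - j))) = C * G'"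
      unfolding G'_def sum_distrib_left
    proof (rule sum.cong[OF refl])
      fix j assume "j \<in> {Suc i..e}"
      hence "j - i = Suc (j - Suc i)" by auto
      thus "monom (u j) 0 * C ^ (j - i) * T ^ (d0 * (e - j)) = C * (monom (u j) 0 * C ^ (j - Suc i) * T ^ (d0 * (e - j)))"
        by (simp add: ac_simps)
    qed
    ultimately show ?thesis by simp
  qed
  have F2: "F = monom f (d0 * (e - i))"
    unfolding F_def f_def monom_sum
  proof (rule sum.cong[OF refl])
    fix j assume "j \<in> {i..e}"
    hence "d0 * (j - i) + d0 * (e - j) = d0 * (e - i)" by (simp add: distrib_left[symmetric])
    thus "monom (u j) 0 * C ^ (j - i) * T ^ (d0 * (e - j)) = monom (u j * c ^ (j - i) * g ^ (d0 * (e - j))) (d0 * (e - i))"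
      by (simp add: C_pow T_pow mult_monom)
  qed
  have fI: "f \<in> ideal_pow I (d0 * (e - i))"
  proof -
    have "F \<in> rees I" unfolding F_def by (intro subring_sum[OF A] Am constA subring_power[OF A] CA TA)
    hence "coeff F (d0 * (e - i)) \<in> ideal_pow I (d0 * (e - i))" unfolding rees_def by blast
    thus ?thesis by (simp add: F2)
  qed
  have "c ^ i * f = (\<Sum>j=i..e. u j * (c ^ j * g ^ (d0 * (e - j))))"
    unfolding f_def sum_distrib_left
  proof (rule sum.cong[OF refl])
    fix j assume "j \<in> {i..e}"
    hence "c ^ j = c ^ i * c ^ (j - i)" by (simp add: power_add[symmetric])
    thus "c ^ i * (u j * c ^ (j - i) * g ^ (d0 * (e - j))) = u j * (c ^ j * g ^ (d0 * (e - j)))"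
      by (simp add: ac_simps)
  qed
  moreover have "d0 * i + d0 * (e - i) = d0 * e" using i by (simp add: distrib_left[symmetric])
  ultimately have CF: "C ^ i * F \<in> rees_extension m I"
    using monom_rees_extension[OF m rel] by (simp add: C_pow F2 mult_monom)
  \<comment> \<open>The degree \<open>d\<close> must reach \<open>d0\<close>, to supply
    \<open>c'\<close>, and exceed \<open>d0 * (e - i)\<close>, so that a positive power of
    \<open>T\<close> brings \<open>F\<close> up to degree \<open>d\<close> as well.\<close>
  have "\<exists>q. detects m I (insert g G) q d" if d: "d \<ge> d0 + Suc (d0 * (e - i))" for d
  proof -
    obtain c' where c': "detects m I G c' d" using G[of d] d by auto
    define k where "k = d - d0 * (e - i)"
    have k: "0 < k" "k + d0 * (e - i) = d" using d by (auto simp: k_def)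
    have "detects m I (insert g G) (c' + g ^ k * f) d"
      unfolding detects_def
    proof (intro conjI allI impI)
      have "g ^ k * f \<in> ideal_pow I d" using ideal_pow_mult[OF I gI fI, of k] k(2) by simp
      thus "c' + g ^ k * f \<in> ideal_pow I d"
        using c' ideal_add[OF is_ideal_ideal_pow[OF I]] unfolding detects_def by blast
      fix P assume P: "prime_of (rees I) P" "rees_extension m I \<subseteq> P"
      have "monom (c' + g ^ k * f) d = monom c' d + T ^ k * F"
        by (simp add: add_monom[symmetric] T_pow F2 mult_monom k(2))
      moreover have "monom c' d + T ^ k * F \<in> P \<longleftrightarrow> (\<forall>g\<in>G. monom g 1 \<in> P) \<and> T \<in> P"
      proof (rule prime_of_combination[OF A P(1) CA TA GA constA constA _ F1])
        show "monom v 0 * monom (u i) 0 = 1" by (simp add: mult_monom v)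
        show "C ^ i * F \<in> P" using CF P(2) by blast
      qed (use c c' P k in \<open>auto simp: C_def detects_def\<close>)
      ultimately show "monom (c' + g ^ k * f) d \<in> P \<longleftrightarrow> (\<forall>g\<in>insert g G. monom g 1 \<in> P)"
        by (auto simp: T_def)
    qed
    thus ?thesis by blast
  qed
  thus ?thesis by blast
qed

lemma detects_finite:
  fixes m I :: "'a::comm_ring_1 set"
  assumes loc: "local_ring m" and I: "is_ideal I" and x: "x \<in> m"
    and e: "\<And>n. length_le ((*) x ` ideal_pow I n) (ideal_pow I n) e"
    and fin: "finite G" and G: "G \<subseteq> I"
  shows "\<exists>d0. \<forall>d\<ge>d0. \<exists>c. detects m I G c d"
  using fin G
proof (induction G rule: finite_induct)
  case empty
  \<comment> \<open>Without generators the condition on primes is vacuous, and 0 lies in every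
    prime.\<close>
  have "detects m I {} 0 d" for d
    unfolding detects_def using ideal_0[OF is_ideal_ideal_pow[OF I]]
    by (auto simp: prime_of_def ideal_of_def)
  thus ?case by blast
next
  case (insert g G)
  then obtain d0 where "\<And>d. d \<ge> d0 \<Longrightarrow> \<exists>c. detects m I G c d" by auto
  thus ?case using detects_insert[OF loc I x _ e] insert.prems by blast
qed

text \<open>Each gt lies in every prime containing mR[It] and ct^d, so some power of it lies in the
  ideal they generate. Reading off coefficients puts g^k in cI^(k-d) + mI^k, hence I^n in cI^(n-d) +
  mI^n for all large n, and Nakayama removes the second summand.\<close>

lemma detects_reduction:
  fixes m I :: "'a::comm_ring_1 set"
  assumes noeth: "noetherian TYPE('a)" and loc: "local_ring m" and I: "I = ideal_gen G" and fin: "finite G"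
    and c: "detects m I G c d"
  shows "\<exists>n0. \<forall>n\<ge>n0. ideal_pow I (n + d) \<subseteq> (*) c ` ideal_pow I n"
proof -
  have m: "is_ideal m" using loc unfolding local_ring_def by auto
  have Ii: "is_ideal I" unfolding I by (rule is_ideal_ideal_gen)
  note A = subring_rees[OF Ii] and N = ideal_of_rees_extension[OF m Ii]
  have GI: "G \<subseteq> I" unfolding I by (rule ideal_gen_superset)
  have cI: "c \<in> ideal_pow I d" using c unfolding detects_def by blast
  have cA: "monom c d \<in> rees I" by (rule monom_rees[OF Ii cI])
  \<comment> \<open>The degree \<open>n\<close> part of the principal ideal of ct^d, which is zero
    below degree \<open>d\<close>.\<close>
  define W where "W n = (if d \<le> n then (*) c ` ideal_pow I (n - d) else {0})" for n
  define V where "V n = ideal_plus (W n) (ideal_prod m (ideal_pow I n))" for n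
  have zero: "is_ideal {0::'a}" by (rule is_idealI) auto
  have W: "is_ideal (W n)" for n unfolding W_def using is_ideal_scale[OF is_ideal_ideal_pow[OF Ii]] zero by auto
  have V: "is_ideal (V n)" for n
    unfolding V_def by (intro is_ideal_ideal_plus W is_ideal_ideal_prod m)
  have step: "v * y \<in> V (Suc n)" if v: "v \<in> V n" and y: "y \<in> I" for n v y
  proof -
    obtain w a where wa: "w \<in> W n" "a \<in> ideal_prod m (ideal_pow I n)" "v = w + a"
      using v unfolding V_def ideal_plus_def by blast
    have y1: "y \<in> ideal_pow I 1" using y ideal_pow_1[OF Ii] by simp
    have "a * y \<in> ideal_prod m (ideal_pow I (Suc n))"
      using ideal_pow_mult_maximal[OF m Ii y1 wa(2)] by (simp add: mult.commute)
    moreover have "w * y \<in> W (Suc n)"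
    proof (cases "d \<le> n")
      case True
      then obtain b where b: "b \<in> ideal_pow I (n - d)" "w = c * b" using wa(1) unfolding W_def by auto
      have "y * b \<in> ideal_pow I (Suc n - d)" using ideal_pow_mult[OF Ii y1 b(1)] True by (simp add: Suc_diff_le)
      moreover have "w * y = c * (y * b)" using b by (simp add: ac_simps)
      ultimately show ?thesis using True unfolding W_def by simp
    next
      case False
      hence "w = 0" using wa(1) unfolding W_def by simp
      thus ?thesis using ideal_0[OF W] by simp
    qed
    ultimately show ?thesis unfolding V_def ideal_plus_def wa(3) distrib_right by blast
  qed
  have powers: "\<exists>k. g ^ k \<in> V k" if g: "g \<in> G" for g
  proof -
    let ?K = "{p + r * monom c d | p r. p \<in> rees_extension m I \<and> r \<in> rees I}"
    note K = ideal_of_adjoin[OF A N cA]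
    have gA: "monom g 1 \<in> rees I" using g GI ideal_pow_1[OF Ii] by (intro monom_rees[OF Ii]) auto
    have "\<exists>k. monom g 1 ^ k \<in> ?K"
    proof (rule power_mem_of_primes[OF A K(1) gA])
      fix P assume P: "prime_of (rees I) P" "?K \<subseteq> P"
      show "monom g 1 \<in> P" using c g P K(2,3) unfolding detects_def by blast
    qed
    then obtain k p r where pr: "p \<in> rees_extension m I" "r \<in> rees I" "monom g 1 ^ k = p + r * monom c d" by blast
    have "g ^ k = coeff (monom g 1 ^ k) k" by (simp add: monom_power)
    also have "\<dots> = coeff (r * monom c d) k + coeff p k" by (simp only: pr(3) coeff_add add.commute)
    finally have gk: "g ^ k = coeff (r * monom c d) k + coeff p k" .
    have "coeff (r * monom c d) k \<in> W k"
      using pr(2) unfolding W_def rees_def mult.commute[of r] by (auto simp: coeff_monom_mult)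
    thus ?thesis unfolding V_def ideal_plus_def using gk pr(1) unfolding rees_extension_def by blast
  qed
  obtain n0 where n0: "\<And>n. n \<ge> n0 \<Longrightarrow> ideal_pow I n \<subseteq> V n"
    using ideal_pow_subset_graded[OF I fin V step powers] by blast
  have "ideal_pow I (n + d) \<subseteq> (*) c ` ideal_pow I n" if "n \<ge> n0" for n
  proof (rule nakayama[OF noeth loc])
    fix y assume "y \<in> ideal_pow I (n + d)"
    hence "y \<in> V (n + d)" using n0[of "n + d"] that by auto
    thus "\<exists>l\<in>(*) c ` ideal_pow I n. \<exists>a\<in>ideal_prod m (ideal_pow I (n + d)). y = l + a"
      unfolding V_def W_def ideal_plus_def by auto
  qed (intro is_ideal_scale is_ideal_ideal_pow Ii)+
  thus ?thesis by blast
qed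

section \<open>Stable ideals\<close>

lemma nzd_cancel: "nzd c \<Longrightarrow> c * x = c * y \<Longrightarrow> x = y"
  unfolding nzd_def by (metis eq_iff_diff_eq_0 right_diff_distrib)

lemma nzd_mult: "nzd a \<Longrightarrow> nzd b \<Longrightarrow> nzd (a * b)"
  unfolding nzd_def mult.assoc by blast

lemma nzd_mult_left: "nzd (a * b) \<Longrightarrow> nzd a"
  unfolding nzd_def by (metis mult.assoc mult.commute mult_zero_right)

lemma nzd_power: "nzd a \<Longrightarrow> nzd (a ^ n)"
proof (induction n)
  case 0
  show ?case by (simp add: nzd_def)
qed (simp add: nzd_mult)

lemma stable_quotient:
  assumes I: "is_ideal I" and stable: "stable I" and c: "nzd c" and x: "x \<in> ideal_pow I d"
    and red: "\<And>n. n \<ge> n0 \<Longrightarrow> ideal_pow I (n + d) \<subseteq> (*) c ` ideal_pow I n" and k: "k \<in> I"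
  obtains k' where "k' \<in> I" "x * k = c * k'"
proof -
  \<comment> \<open>The exponent is \<open>Suc n0\<close> and not \<open>n0\<close> because
    \<open>blowup\<close> ranges over positive exponents only.\<close>
  have "x * l \<in> (*) c ` ideal_pow I (Suc n0)" if "l \<in> ideal_pow I (Suc n0)" for l
    using red[of "Suc n0"] ideal_pow_mult[OF I x that] by (auto simp: add.commute)
  hence "(x, c) \<in> colon_Q (ideal_pow I (Suc n0))" using c unfolding colon_Q_def by blast
  hence "(x, c) \<in> blowup I" unfolding blowup_def by blast
  hence "(x, c) \<in> colon_Q I" using stable unfolding stable_def by blast
  thus ?thesis using k that unfolding colon_Q_def by blast
qed

lemma stable_square:
  fixes m I :: "'a::comm_ring_1 set"
  assumes noeth: "noetherian TYPE('a)" and loc: "local_ring m" and dim: "krull_dim TYPE('a) = 1"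
    and I: "is_ideal I" and stable: "stable I"
  shows "\<exists>z\<in>I. nzd z \<and> (\<forall>x\<in>I. \<forall>y\<in>I. \<exists>t\<in>I. x * y = z * t)"
\<comment> \<open>The unit ideal stands apart: a nonzerodivisor in a proper \<open>I\<close> lies in
  \<open>m\<close>, as the relations modulo \<open>m\<close> require.\<close>
proof (cases "I = UNIV")
  case True
  thus ?thesis by (intro bexI[of _ 1]) (auto simp: nzd_def)
next
  case False
  obtain s where s: "nzd s" "s \<in> I" using stable unfolding stable_def regular_ideal_def by blast
  have sm: "s \<in> m" using s(2) loc I False unfolding local_ring_def by blast
  have sI: "s ^ n \<in> ideal_pow I n" for n
    using ideal_pow_power[OF I, of s 1 n] ideal_pow_1[OF I] s(2) by simp
  have "s \<in> (*) s ` UNIV" by (rule image_eqI[of _ _ 1]) simp_all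
  then obtain e where e: "length_le ((*) s ` UNIV) UNIV e"
    using finite_length[OF noeth loc dim is_ideal_scale[OF is_ideal_UNIV] s(1)] by blast
  have len: "length_le ((*) s ` ideal_pow I n) (ideal_pow I n) e" for n
  proof -
    obtain f where "length_le (ideal_pow I n) UNIV f"
      using finite_length[OF noeth loc dim is_ideal_ideal_pow[OF I] nzd_power[OF s(1)] sI] by blast
    thus ?thesis by (rule length_le_self_scale[OF is_ideal_ideal_pow[OF I] _ s(1) e])
  qed
  obtain G where G: "finite G" "I = ideal_gen G" using noeth I unfolding noetherian_def by blast
  have "G \<subseteq> I" unfolding G(2) by (rule ideal_gen_superset)
  then obtain d where d: "\<And>l. l \<ge> d \<Longrightarrow> \<exists>c. detects m I G c l"
    using detects_finite[OF loc I sm len G(1)] by blast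
  obtain c where c: "detects m I G c d" using d[of d] by blast
  obtain c' where c': "detects m I G c' (Suc d)" using d[of "Suc d"] by auto
  have cI: "c \<in> ideal_pow I d" "c' \<in> ideal_pow I (Suc d)" using c c' unfolding detects_def by auto
  obtain n0 where n0: "\<And>n. n \<ge> n0 \<Longrightarrow> ideal_pow I (n + d) \<subseteq> (*) c ` ideal_pow I n"
    using detects_reduction[OF noeth loc G(2,1) c] by blast
  obtain n1 where n1: "\<And>n. n \<ge> n1 \<Longrightarrow> ideal_pow I (n + Suc d) \<subseteq> (*) c' ` ideal_pow I n"
    using detects_reduction[OF noeth loc G(2,1) c'] by blast
  \<comment> \<open>A power of the nonzerodivisor \<open>s\<close> is a multiple of
    \<open>c\<close>, so \<open>c\<close> is a nonzerodivisor too.\<close>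
  have "s ^ (n0 + d) \<in> (*) c ` ideal_pow I n0" using n0[of n0] sI by blast
  then obtain y where "s ^ (n0 + d) = c * y" by blast
  hence nc: "nzd c" using nzd_power[OF s(1)] nzd_mult_left by metis
  have "s ^ (n1 + Suc d) \<in> (*) c' ` ideal_pow I n1" using n1[of n1] sI by blast
  then obtain y where "s ^ (n1 + Suc d) = c' * y" by blast
  hence nc': "nzd c'" using nzd_power[OF s(1)] nzd_mult_left by metis
  have "ideal_pow I (Suc d) \<subseteq> (*) c ` I" unfolding ideal_pow.simps
  proof (rule ideal_prod_least[OF is_ideal_scale[OF I]])
    fix a b assume "a \<in> I" "b \<in> ideal_pow I d"
    then obtain k' where "k' \<in> I" "b * a = c * k'" using stable_quotient[OF I stable nc _ n0] by blast
    thus "a * b \<in> (*) c ` I" by (auto simp: mult.commute)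
  qed
  then obtain z where z: "z \<in> I" "c' = c * z" using cI(2) by blast
  \<comment> \<open>Since xc lies in I^(d+1), the fraction xc/c' lies in I : I; hence xcy = c't =
    czt with t in \<open>I\<close>, and c cancels.\<close>
  have sq: "\<exists>t\<in>I. x * y = z * t" if x: "x \<in> I" and y: "y \<in> I" for x y
  proof -
    have "x * c \<in> ideal_pow I (Suc d)" using ideal_prodI[OF x cI(1)] by simp
    then obtain t where t: "t \<in> I" "(x * c) * y = c' * t" using stable_quotient[OF I stable nc' _ n1 y] by blast
    have "c * (x * y) = c * (z * t)" using t(2) z(2) by (simp add: ac_simps)
    thus ?thesis using nzd_cancel[OF nc] t(1) by blast
  qed
  obtain t where "s * s = z * t" using sq[OF s(2) s(2)] by blast
  hence "nzd z" using nzd_mult[OF s(1) s(1)] nzd_mult_left by metis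
  thus ?thesis using z(1) sq by blast
qed

section \<open>Homomorphisms and traces\<close>

text \<open>Multiplication by the fraction a/c, which maps \<open>K\<close> to \<open>L\<close> as
  soon as aK is inside cL; cancelling \<open>c\<close> gives linearity.\<close>

lemma hom_quotient:
  assumes K: "is_ideal K" and c: "nzd c" and a: "\<And>k. k \<in> K \<Longrightarrow> \<exists>r\<in>L. a * k = c * r"
  obtains f where "f \<in> Hom K L" "\<And>k. k \<in> K \<Longrightarrow> a * k = c * f k"
proof -
  obtain h where h: "\<And>k. k \<in> K \<Longrightarrow> h k \<in> L \<and> a * k = c * h k" using a by metis
  define f where "f k = (if k \<in> K then h k else 0)" for k
  have f: "f k \<in> L" "a * k = c * f k" if "k \<in> K" for k using h[OF that] that by (auto simp: f_def)
  have "f (x + y) = f x + f y" if "x \<in> K" "y \<in> K" for x y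
    using f(2)[OF that(1)] f(2)[OF that(2)] f(2)[OF ideal_add[OF K that]]
    by - (rule nzd_cancel[OF c], simp add: distrib_left)
  moreover have "f (r * x) = r * f x" if "x \<in> K" for r x
    using f(2)[OF that] f(2)[OF ideal_mult[OF K that, of r]]
    by - (rule nzd_cancel[OF c], metis mult.left_commute)
  ultimately have "f \<in> Hom K L" using f(1) unfolding Hom_def by (auto simp: f_def)
  thus ?thesis using f(2) that by blast
qed

lemma hom_mem_trace:
  assumes "f \<in> Hom K UNIV" "x \<in> K" shows "f x \<in> trace K"
  unfolding trace_def using assms
  by (intro CollectI exI[of _ 1] exI[of _ "\<lambda>_. f"] exI[of _ "\<lambda>_. x"]) auto

text \<open>Both sides equal \<open>f (x * y)\<close>. When \<open>x\<close> is a nonzerodivisor,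
  \<open>f\<close> is therefore multiplication by the fraction f(x)/x.\<close>

lemma hom_commute:
  assumes "f \<in> Hom K L" "x \<in> K" "y \<in> K" shows "x * f y = y * f x"
proof -
  have "f (r * x) = r * f x" if "x \<in> K" for r x using assms(1) that unfolding Hom_def by blast
  thus ?thesis using assms(2,3) by (metis mult.commute)
qed

lemma mod_iso_Hom:
  assumes I: "is_ideal I" and z: "z \<in> I" "nzd z"
  shows "mod_iso (Hom I J) hom_add hom_smult {a. \<forall>x\<in>I. \<exists>y\<in>J. a * x = z * y} (+) (*)"
  unfolding mod_iso_def
proof (intro exI[of _ "\<lambda>f. f z"] conjI ballI allI)
  show "bij_betw (\<lambda>f. f z) (Hom I J) {a. \<forall>x\<in>I. \<exists>y\<in>J. a * x = z * y}"
  proof (rule bij_betwI')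
    fix f g assume f: "f \<in> Hom I J" and g: "g \<in> Hom I J"
    have "f = g" if eq: "f z = g z"
    proof
      fix x
      show "f x = g x"
      proof (cases "x \<in> I")
        case True
        thus ?thesis using hom_commute[OF f z(1) True] hom_commute[OF g z(1) True] eq
          by - (rule nzd_cancel[OF z(2)], simp)
      next
        case False
        thus ?thesis using f g unfolding Hom_def by simp
      qed
    qed
    thus "f z = g z \<longleftrightarrow> f = g" by blast
  next
    fix f assume f: "f \<in> Hom I J"
    have "\<exists>y\<in>J. f z * x = z * y" if "x \<in> I" for x
      using hom_commute[OF f z(1) that] f that unfolding Hom_def by (intro bexI[of _ "f x"]) (auto simp: mult.commute)
    thus "f z \<in> {a. \<forall>x\<in>I. \<exists>y\<in>J. a * x = z * y}" by blast
  next
    fix a assume "a \<in> {a. \<forall>x\<in>I. \<exists>y\<in>J. a * x = z * y}"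
    then obtain f where f: "f \<in> Hom I J" "\<And>k. k \<in> I \<Longrightarrow> a * k = z * f k"
      using hom_quotient[OF I z(2), of J a] by blast
    have "a = f z" using f(2)[OF z(1)] by - (rule nzd_cancel[OF z(2)], simp add: mult.commute)
    thus "\<exists>f\<in>Hom I J. a = f z" using f(1) by blast
  qed
qed (simp_all add: hom_add_def hom_smult_def)

text \<open>The first isomorphism is composed with the inverse of the second; closure of
  \<open>N\<close> keeps the sums and multiples to be compared where that inverse is valid.\<close>

lemma mod_iso_common_target:
  assumes M: "mod_iso M addM smM T addT smT" and N: "mod_iso N addN smN T addT smT"
    and closed: "\<And>x y. x \<in> N \<Longrightarrow> y \<in> N \<Longrightarrow> addN x y \<in> N" "\<And>r x. x \<in> N \<Longrightarrow> smN r x \<in> N"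
  shows "mod_iso M addM smM N addN smN"
proof -
  obtain f where f: "bij_betw f M T" "\<forall>x\<in>M. \<forall>y\<in>M. f (addM x y) = addT (f x) (f y)"
    "\<forall>r. \<forall>x\<in>M. f (smM r x) = smT r (f x)" using M unfolding mod_iso_def by blast
  obtain g where g: "bij_betw g N T" "\<forall>x\<in>N. \<forall>y\<in>N. g (addN x y) = addT (g x) (g y)"
    "\<forall>r. \<forall>x\<in>N. g (smN r x) = smT r (g x)" using N unfolding mod_iso_def by blast
  let ?h = "inv_into N g"
  have bij: "bij_betw (?h \<circ> f) M N" using bij_betw_trans[OF f(1) bij_betw_inv_into[OF g(1)]] .
  have hN: "?h (f x) \<in> N" and gh: "g (?h (f x)) = f x" if "x \<in> M" for x
    using f(1) g(1) that unfolding bij_betw_def by (auto intro: inv_into_into f_inv_into_f)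
  have hg: "?h (g y) = y" if "y \<in> N" for y using g(1) that by (simp add: bij_betw_inv_into_left)
  have "?h (f (addM x y)) = addN (?h (f x)) (?h (f y))" if xy: "x \<in> M" "y \<in> M" for x y
  proof -
    have "f (addM x y) = g (addN (?h (f x)) (?h (f y)))" using f(2) g(2) xy hN gh by simp
    thus ?thesis using hg closed(1) hN xy by simp
  qed
  moreover have "?h (f (smM r x)) = smN r (?h (f x))" if x: "x \<in> M" for r x
  proof -
    have "f (smM r x) = g (smN r (?h (f x)))" using f(3) g(3) x hN gh by simp
    thus ?thesis using hg closed(2) hN x by simp
  qed
  ultimately show ?thesis using bij unfolding mod_iso_def by (intro exI[of _ "?h \<circ> f"]) auto
qed

lemma mod_iso_refl: "mod_iso M addM smM M addM smM"
  unfolding mod_iso_def by (intro exI[of _ id]) auto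

lemma Hom_closed:
  assumes "is_ideal L" "f \<in> Hom K L"
  shows "g \<in> Hom K L \<Longrightarrow> hom_add f g \<in> Hom K L" and "hom_smult r f \<in> Hom K L"
  using assms unfolding Hom_def hom_add_def hom_smult_def
  by (auto simp: image_subset_iff ideal_add ideal_mult algebra_simps)

section \<open>Colon ideals and the trace of the product\<close>

text \<open>If a carries IJ into zwR, then ax/(zw) maps \<open>J\<close> to R, hence into tr(J) = J,
  and its value at \<open>w\<close> is ax/z, so ax lies in zJ. The converse multiplies by y in
  \<open>J\<close> and uses that products of two elements of \<open>J\<close> lie in wJ.\<close>

lemma colon_eq_prod_colon:
  assumes J: "is_ideal J" and tr: "trace J = J" and z: "nzd z" and w: "w \<in> J" "nzd w"
    and sq: "\<And>x y. x \<in> J \<Longrightarrow> y \<in> J \<Longrightarrow> \<exists>t\<in>J. x * y = w * t"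
  shows "{a. \<forall>x\<in>I. \<exists>y\<in>J. a * x = z * y} = {a. \<forall>x\<in>I. \<forall>y\<in>J. \<exists>r. a * x * y = z * w * r}"
proof (intro set_eqI iffI; unfold mem_Collect_eq; intro ballI)
  fix a x y assume "\<forall>x\<in>I. \<exists>y\<in>J. a * x = z * y" "x \<in> I" and y: "y \<in> J"
  then obtain v where v: "v \<in> J" "a * x = z * v" by blast
  obtain t where "v * y = w * t" using sq[OF v(1) y] by blast
  hence "a * x * y = z * w * t" by (simp add: v(2) mult.assoc)
  thus "\<exists>r. a * x * y = z * w * r" ..
next
  fix a x assume "\<forall>x\<in>I. \<forall>y\<in>J. \<exists>r. a * x * y = z * w * r" and "x \<in> I"
  hence "\<exists>r\<in>UNIV. (a * x) * k = (z * w) * r" if "k \<in> J" for k using that by blast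
  then obtain f where f: "f \<in> Hom J UNIV" "\<And>k. k \<in> J \<Longrightarrow> (a * x) * k = (z * w) * f k"
    using hom_quotient[OF J nzd_mult[OF z w(2)], of UNIV "a * x"] by blast
  have "f w \<in> J" using hom_mem_trace[OF f(1) w(1)] tr by simp
  moreover have "w * (a * x) = w * (z * f w)" using f(2)[OF w(1)] by (simp add: ac_simps)
  hence "a * x = z * f w" by (rule nzd_cancel[OF w(2)])
  ultimately show "\<exists>y\<in>J. a * x = z * y" by blast
qed

text \<open>For P = IJ, products of two elements of P lie in zwP. So for \<alpha> from P to R, n in
  P, x in \<open>I\<close> and y in \<open>J\<close>, \<alpha>(n)xy = \<alpha>(nxy) is \<alpha>(zwt)
  with t in P, a multiple of zw. Conversely, an a with aP \<subseteq> zwR is the value at zw of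
  multiplication by a/(zw).\<close>

lemma trace_ideal_prod:
  assumes I: "is_ideal I" and J: "is_ideal J" and z: "z \<in> I" "nzd z" and w: "w \<in> J" "nzd w"
    and sqI: "\<And>x y. x \<in> I \<Longrightarrow> y \<in> I \<Longrightarrow> \<exists>t\<in>I. x * y = z * t"
    and sqJ: "\<And>x y. x \<in> J \<Longrightarrow> y \<in> J \<Longrightarrow> \<exists>t\<in>J. x * y = w * t"
  shows "trace (ideal_prod I J) = {a. \<forall>x\<in>I. \<forall>y\<in>J. \<exists>r. a * x * y = z * w * r}" (is "_ = ?T")
proof
  let ?P = "ideal_prod I J"
  have P: "is_ideal ?P" by (rule is_ideal_ideal_prod[OF I])
  have zwP: "z * w \<in> ?P" by (rule ideal_prodI[OF z(1) w(1)])
  have zw: "nzd (z * w)" by (rule nzd_mult[OF z(2) w(2)])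
  have T: "?T = {a. \<forall>x\<in>I. \<forall>y\<in>J. a * (x * y) \<in> (*) (z * w) ` UNIV}" by (auto simp: mult.assoc image_iff)
  have mult: "n * (x * y) \<in> (*) (z * w) ` ?P" if n: "n \<in> ?P" and x: "x \<in> I" and y: "y \<in> J" for n x y
  proof -
    have "?P \<subseteq> {n. n * (x * y) \<in> (*) (z * w) ` ?P}"
    proof (rule ideal_prod_least[OF is_ideal_colon[OF is_ideal_scale[OF P]]])
      fix a b assume a: "a \<in> I" and b: "b \<in> J"
      obtain t t' where t: "t \<in> I" "a * x = z * t" "t' \<in> J" "b * y = w * t'"
        using sqI[OF a x] sqJ[OF b y] by blast
      have "(a * b) * (x * y) = (a * x) * (b * y)" by (simp add: ac_simps)
      also have "\<dots> = (z * w) * (t * t')" unfolding t(2,4) by (simp add: ac_simps)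
      finally have "(a * b) * (x * y) = (z * w) * (t * t')" .
      moreover have "t * t' \<in> ?P" using t(1,3) by (rule ideal_prodI)
      ultimately show "a * b \<in> {n. n * (x * y) \<in> (*) (z * w) ` ?P}" by blast
    qed
    thus ?thesis using n by blast
  qed
  show "trace ?P \<subseteq> ?T"
  proof
    fix a assume "a \<in> trace ?P"
    then obtain k :: nat and \<alpha> n where a: "a = (\<Sum>i<k. \<alpha> i (n i))" "\<forall>i<k. \<alpha> i \<in> Hom ?P UNIV \<and> n i \<in> ?P"
      unfolding trace_def by blast
    have "a * (x * y) \<in> (*) (z * w) ` UNIV" if x: "x \<in> I" and y: "y \<in> J" for x y
      unfolding a(1) sum_distrib_right
    proof (rule ideal_sum[OF is_ideal_scale[OF is_ideal_UNIV]])
      fix i assume "i \<in> {..<k}"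
      hence i: "\<alpha> i \<in> Hom ?P UNIV" "n i \<in> ?P" using a(2) by auto
      obtain t where t: "t \<in> ?P" "n i * (x * y) = z * w * t" using mult[OF i(2) x y] by blast
      have lin: "\<alpha> i (r * v) = r * \<alpha> i v" if "v \<in> ?P" for r v using i(1) that unfolding Hom_def by blast
      have "\<alpha> i (n i) * (x * y) = \<alpha> i ((x * y) * n i)" unfolding lin[OF i(2)] by (rule mult.commute)
      also have "\<dots> = \<alpha> i ((z * w) * t)" using t(2) by (simp add: mult.commute)
      also have "\<dots> = (z * w) * \<alpha> i t" by (rule lin[OF t(1)])
      finally show "\<alpha> i (n i) * (x * y) \<in> (*) (z * w) ` UNIV" by blast
    qed
    thus "a \<in> ?T" unfolding T by blast
  qed
  show "?T \<subseteq> trace ?P"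
  proof
    fix a assume a: "a \<in> ?T"
    have "?P \<subseteq> {k. k * a \<in> (*) (z * w) ` UNIV}"
      using a unfolding T
      by (intro ideal_prod_least is_ideal_colon is_ideal_scale is_ideal_UNIV) (auto simp: mult.commute)
    hence "a * k \<in> (*) (z * w) ` UNIV" if "k \<in> ?P" for k using that unfolding mult.commute[of a] by blast
    hence "\<exists>r\<in>UNIV. a * k = (z * w) * r" if "k \<in> ?P" for k using that by (simp add: image_iff)
    then obtain f where f: "f \<in> Hom ?P UNIV" "\<And>k. k \<in> ?P \<Longrightarrow> a * k = (z * w) * f k"
      using hom_quotient[OF P zw, of UNIV a] by blast
    have "a = f (z * w)" using f(2)[OF zwP] by - (rule nzd_cancel[OF zw], simp add: mult.commute)
    thus "a \<in> trace ?P" using hom_mem_trace[OF f(1) zwP] by simp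
  qed
qed

text \<open>Writing xa = zb, the square relation of \<open>I\<close> places b only in
  \<open>I\<close>; the trace property of the intersection also places it in \<open>J\<close>, and
  then yb lies in wJ.\<close>

lemma trace_Int_subset_prod_colon:
  assumes K: "is_ideal (I \<inter> J)" and tr: "trace (I \<inter> J) = I \<inter> J" and z: "nzd z" and w: "nzd w"
    and sqI: "\<And>x y. x \<in> I \<Longrightarrow> y \<in> I \<Longrightarrow> \<exists>t\<in>I. x * y = z * t"
    and sqJ: "\<And>x y. x \<in> J \<Longrightarrow> y \<in> J \<Longrightarrow> \<exists>t\<in>J. x * y = w * t"
    and a: "a \<in> I \<inter> J" and x: "x \<in> I" and y: "y \<in> J"
  shows "\<exists>r. a * x * y = z * w * r"
proof -
  have "\<exists>r\<in>UNIV. x * k = z * r" if "k \<in> I \<inter> J" for k using sqI[OF x] that by blast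
  then obtain f where f: "f \<in> Hom (I \<inter> J) UNIV" "\<And>k. k \<in> I \<inter> J \<Longrightarrow> x * k = z * f k"
    using hom_quotient[OF K z, of UNIV x] by blast
  have fa: "f a \<in> I \<inter> J" using hom_mem_trace[OF f(1) a] tr by simp
  obtain t where "y * f a = w * t" using sqJ[OF y] fa by blast
  hence "z * w * t = z * (y * f a)" by (simp add: mult.assoc)
  also have "\<dots> = y * (x * a)" using f(2)[OF a] by (simp add: mult.left_commute)
  finally have "a * x * y = z * w * t" by (simp add: ac_simps)
  thus ?thesis ..
qed

theorem theorem5p4:
  fixes m I J :: "'a::comm_ring_1 set"
  assumes "noetherian TYPE('a)" and "local_ring m"
    and "krull_dim TYPE('a) = 1" and "depth m = krull_dim TYPE('a)"
    and "is_ideal I" and "regular_ideal I" and "stable I" and "trace_ideal I"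
    and "is_ideal J" and "regular_ideal J" and "stable J" and "trace_ideal J"
  shows "mod_iso (Hom I J) hom_add hom_smult (Hom J I) hom_add hom_smult
       \<and> mod_iso (Hom J I) hom_add hom_smult (trace (ideal_prod I J)) (+) (*)
       \<and> (stable (I \<inter> J) \<and> trace_ideal (I \<inter> J) \<longrightarrow>
            mod_iso (trace (ideal_prod I J)) (+) (*) (I \<inter> J) (+) (*))"
proof -
  note I = assms(5) and J = assms(9)
  have trI: "trace I = I" and trJ: "trace J = J" using assms(8,12) unfolding trace_ideal_def by auto
  obtain z where z: "z \<in> I" "nzd z" and "\<forall>x\<in>I. \<forall>y\<in>I. \<exists>t\<in>I. x * y = z * t"
    using stable_square[OF assms(1-3) I assms(7)] by blast
  hence sqI: "\<exists>t\<in>I. x * y = z * t" if "x \<in> I" "y \<in> I" for x y using that by simp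
  obtain w where w: "w \<in> J" "nzd w" and "\<forall>x\<in>J. \<forall>y\<in>J. \<exists>t\<in>J. x * y = w * t"
    using stable_square[OF assms(1-3) J assms(11)] by blast
  hence sqJ: "\<exists>t\<in>J. x * y = w * t" if "x \<in> J" "y \<in> J" for x y using that by simp
  define T where "T = {a. \<forall>x\<in>I. \<forall>y\<in>J. \<exists>r. a * x * y = z * w * r}"
  have TJ: "{a. \<forall>x\<in>I. \<exists>y\<in>J. a * x = z * y} = T"
    unfolding T_def by (rule colon_eq_prod_colon[OF J trJ z(2) w sqJ])
  have "{a. \<forall>x\<in>J. \<exists>y\<in>I. a * x = w * y} = {a. \<forall>x\<in>J. \<forall>y\<in>I. \<exists>r. a * x * y = w * z * r}"
    by (rule colon_eq_prod_colon[OF I trI w(2) z sqI])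
  also have "\<dots> = T"
  proof -
    have "a * x * y = w * z * r \<longleftrightarrow> a * y * x = z * w * r" for a x y r by (simp add: ac_simps)
    thus ?thesis unfolding T_def by blast
  qed
  finally have TI: "{a. \<forall>x\<in>J. \<exists>y\<in>I. a * x = w * y} = T" .
  have tr: "trace (ideal_prod I J) = T"
    unfolding T_def by (rule trace_ideal_prod[OF I J z w sqI sqJ])
  have HI: "mod_iso (Hom I J) hom_add hom_smult T (+) (*)" using mod_iso_Hom[OF I z, of J] TJ by simp
  have HJ: "mod_iso (Hom J I) hom_add hom_smult T (+) (*)" using mod_iso_Hom[OF J w, of I] TI by simp
  have "mod_iso (Hom I J) hom_add hom_smult (Hom J I) hom_add hom_smult"
    by (rule mod_iso_common_target[OF HI HJ]) (simp_all add: Hom_closed[OF I])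
  \<comment> \<open>The two descriptions of \<open>T\<close> as a colon give one inclusion: tested
    at \<open>z\<close>, the first puts \<open>a\<close> in \<open>J\<close>; tested at
    \<open>w\<close>, the second puts \<open>a\<close> in \<open>I\<close>.\<close>
  moreover have "T = I \<inter> J" if "trace_ideal (I \<inter> J)"
  proof (intro equalityI subsetI)
    fix a assume a: "a \<in> T"
    obtain y where "y \<in> J" "a * z = z * y" using a[folded TJ] z(1) by blast
    moreover obtain x where "x \<in> I" "a * w = w * x" using a[folded TI] w(1) by blast
    ultimately show "a \<in> I \<inter> J" using nzd_cancel[OF z(2), of a y] nzd_cancel[OF w(2), of a x] by (simp add: mult.commute)
  next
    fix a assume "a \<in> I \<inter> J"
    thus "a \<in> T" using trace_Int_subset_prod_colon[OF _ _ z(2) w(2) sqI sqJ, of a] that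
      unfolding T_def trace_ideal_def by blast
  qed
  \<comment> \<open>The last isomorphism is the identity, since tr(IJ) and the intersection both
    equal \<open>T\<close>.\<close>
  ultimately show ?thesis using HJ mod_iso_refl unfolding tr by metis
qed

end
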